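(* There is an absolute constant $C>0$ such that, for all $s\in(0,1]$: - for expanding averaging systems whose graphs are all connected ($m=1$), $\mathcal{E}^{\mathrm{EXP}}_{1,s}\le Cd^3/(sh^2)$; - for $1\le m\le n-1$, $\mathcal{E}^{\mathrm{EXP}}_{m,s}\le (c/s)^m$ with $c=Cd^3mn/h^2$.
   Context: Fix $n\ge2$, an integer $d\ge2$ and $h>0$. Let $(G_t)_{t\ge0}$ be undirected graphs on $[n]$, each with a self-loop at every vertex. Let $M_t$ be the $0/1$ adjacency matrix of $G_t$, including the diagonal ones from the self-loops. An expanding averaging system is one in which: - every row of $M_t$ sums to $d$ (so $G_t$ is $d$-regular counting its self-loop); - every connected component of every $G_t$ has Cheeger constant at least $h$, i.e., for every set $X$ of at most half the vertices of that component, the number of edges with exactly one endpoint in $X$ is at least $h|X|$. The dynamics is $P_t=M_t/d$, $x(t+1)=P_tx(t)$. Write $q=d\mathbf{1}$. At time $t$, each edge $\{i,j\}$ of $G_t$ with $i\ne j$ is embedded as the closed interval with endpoints $x_i(t),x_j(t)$. The union of these intervals is a disjoint union of closed intervals (blocks) with lengths $l_1(t),\dots,l_{k_t}(t)$. Set $E_{s,t}=\sum_il_i(t)^s$ and $E_s=\sum_{t\ge0}E_{s,t}$. $\mathcal{E}^{\mathrm{EXP}}_{m,s}$ is the supremum of $E_s$ over all such systems in which every $G_t$ has at most $m$ connected components, and over all $x(0)$ with $\sum_iq_i(x_i(0)-\mu)^2\le1$, where $\mu=\frac1n\sum_ix_i(0)$. *)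

theory Defs
  imports "HOL-Analysis.Analysis"
begin

text \<open>Undirected graph on [n] with a self-loop at every vertex, d-regular counting the loop
  (row sums of the 0/1 adjacency matrix incl. diagonal equal d).\<close>
definition regular_loop_graph :: "nat \<Rightarrow> nat \<Rightarrow> (nat \<Rightarrow> nat \<Rightarrow> bool) \<Rightarrow> bool" where
  "regular_loop_graph n d G \<longleftrightarrow>
     (\<forall>i j. G i j \<longrightarrow> i < n \<and> j < n) \<and>
     (\<forall>i j. G i j \<longrightarrow> G j i) \<and>
     (\<forall>i<n. G i i) \<and>
     (\<forall>i<n. card {j. j < n \<and> G i j} = d)"

definition graph_components :: "nat \<Rightarrow> (nat \<Rightarrow> nat \<Rightarrow> bool) \<Rightarrow> nat set set" where
  "graph_components n G = {{j. j < n \<and> G\<^sup>*\<^sup>* i j} | i. i < n}"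

definition cheeger_at_least :: "nat \<Rightarrow> (nat \<Rightarrow> nat \<Rightarrow> bool) \<Rightarrow> real \<Rightarrow> bool" where
  "cheeger_at_least n G h \<longleftrightarrow>
     (\<forall>K \<in> graph_components n G. \<forall>X. X \<subseteq> K \<and> 2 * card X \<le> card K \<longrightarrow>
        h * real (card X) \<le> real (card {(i, j). i \<in> X \<and> j < n \<and> j \<notin> X \<and> G i j}))"

definition exp_averaging_system ::
  "nat \<Rightarrow> nat \<Rightarrow> real \<Rightarrow> nat \<Rightarrow> (nat \<Rightarrow> nat \<Rightarrow> nat \<Rightarrow> bool) \<Rightarrow> (nat \<Rightarrow> nat \<Rightarrow> real) \<Rightarrow> bool" where
  "exp_averaging_system n d h m A x \<longleftrightarrow>
     (\<forall>t. regular_loop_graph n d (A t) \<and> cheeger_at_least n (A t) h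
          \<and> card (graph_components n (A t)) \<le> m) \<and>
     (\<forall>t. \<forall>i<n. x (Suc t) i = (\<Sum>j\<in>{j. j < n \<and> A t i j}. x t j) / real d)"

definition edge_union :: "nat \<Rightarrow> (nat \<Rightarrow> nat \<Rightarrow> bool) \<Rightarrow> (nat \<Rightarrow> real) \<Rightarrow> real set" where
  "edge_union n G y =
     \<Union> {{min (y i) (y j) .. max (y i) (y j)} | i j. i < n \<and> j < n \<and> i \<noteq> j \<and> G i j}"

definition block_energy :: "real \<Rightarrow> nat \<Rightarrow> (nat \<Rightarrow> nat \<Rightarrow> bool) \<Rightarrow> (nat \<Rightarrow> real) \<Rightarrow> real" where
  "block_energy s n G y = (\<Sum>B\<in>components (edge_union n G y). (Sup B - Inf B) powr s)"

end

theory Submission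
  imports Defs
begin

text \<open>Let \<open>V\<close> be \<open>d\<close> times the sum of squared deviations from the mean. One step lowers \<open>V\<close> by at
  least \<open>1 / d\<close> times the sum of \<open>(x i - x j)\<^sup>2\<close> over ordered edges, and by Cheeger's inequality
  this is at least \<open>h\<^sup>2 / d\<^sup>2\<close> times the sum of the squared deviations within the components. For
  connected graphs \<open>V\<close> thus contracts by \<open>1 - h\<^sup>2 / d\<^sup>3\<close> per step, and every block has length at
  most \<open>V\<close> to the power \<open>1/2\<close>; a geometric series gives the first bound.

  In general, start at time \<open>t0\<close> and wait until every cut of the agents by their value at time
  \<open>t0\<close> has been crossed by an edge. Components spanning the cuts then account for the whole initial
  range, so \<open>V\<close> has contracted by \<open>1 - h\<^sup>2 / (4 d\<^sup>3 m n)\<close>. Before that moment some cut is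
  uncrossed, so the system splits into two independent systems with at most \<open>m - 1\<close>
  components each, whose energies are bounded by induction on \<open>m\<close>. Since \<open>s \<le> 1\<close>, the block
  energy is at most the sum over graph components of the \<open>s\<close>-th power of their spread, and the
  latter is additive over such a splitting.\<close>

subsection \<open>Powers, intervals and deviations\<close>

text \<open>Weighted AM-GM for the numbers \<open>1 - u\<close> and \<open>1\<close> with weights
  \<open>a\<close> and \<open>1 - a\<close>. It needs positive numbers, so \<open>u = 1\<close> is
  set apart.\<close>

lemma powr_le_linear:
  fixes a u :: real
  assumes "0 \<le> a" "a \<le> 1" "0 \<le> u" "u \<le> 1"
  shows "(1 - u) powr a \<le> 1 - a * u"
proof (cases "u = 1")
  case False
  then show ?thesis
    using Youngs_inequality_0[of a "1 - a" "1 - u" 1] assms by (simp add: algebra_simps)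
qed (use assms in simp)

text \<open>Used with \<open>a = s / 2\<close>: a relative loss \<open>u\<close> of the potential
  becomes a relative loss \<open>s * u / 2\<close> of its power. This is where the factor
  \<open>1 / s\<close> in the final bounds originates.\<close>

lemma powr_contraction_le:
  fixes a u v w :: real
  assumes "0 \<le> a" "a \<le> 1" "0 \<le> u" "u \<le> 1" "0 \<le> v" "v \<le> (1 - u) * w" "0 \<le> w"
  shows "v powr a \<le> (1 - a * u) * w powr a"
proof -
  have "v powr a \<le> ((1 - u) * w) powr a" using assms by (intro powr_mono2) auto
  also have "\<dots> = (1 - u) powr a * w powr a" using assms by (simp add: powr_mult)
  also have "\<dots> \<le> (1 - a * u) * w powr a"
    using assms by (intro mult_right_mono powr_le_linear) auto
  finally show ?thesis .
qed

text \<open>The fractions \<open>a / (a + b)\<close> and \<open>b / (a + b)\<close> add up to 1, and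
  raising a number from [0,1] to a power \<open>s\<close> of at most 1 can only increase it.\<close>

lemma powr_add_le:
  fixes a b s :: real
  assumes "0 \<le> a" "0 \<le> b" "0 < s" "s \<le> 1"
  shows "(a + b) powr s \<le> a powr s + b powr s"
proof (cases "a + b = 0")
  case False
  then have pos: "a + b > 0" using assms by linarith
  have *: "(a + b) powr s * (u / (a + b)) \<le> u powr s" if "0 \<le> u" "u \<le> a + b" for u
  proof -
    have "u / (a + b) \<le> (u / (a + b)) powr s"
      using that pos assms powr_mono'[of s 1 "u / (a + b)"] by simp
    then have "(a + b) powr s * (u / (a + b)) \<le> (a + b) powr s * (u / (a + b)) powr s"
      by (intro mult_left_mono) auto
    also have "\<dots> = u powr s" using that pos by (simp add: powr_divide)
    finally show ?thesis .
  qed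
  have "(a + b) powr s = (a + b) powr s * (a / (a + b)) + (a + b) powr s * (b / (a + b))"
    using pos by (simp flip: distrib_left add_divide_distrib)
  also have "\<dots> \<le> a powr s + b powr s"
    by (intro add_mono *) (use assms in auto)
  finally show ?thesis .
qed (use assms in auto)

lemma powr_sum_le:
  fixes f :: "'a \<Rightarrow> real" and s :: real
  assumes "finite I" "\<And>i. i \<in> I \<Longrightarrow> 0 \<le> f i" "0 < s" "s \<le> 1"
  shows "(\<Sum>i\<in>I. f i) powr s \<le> (\<Sum>i\<in>I. f i powr s)"
  using assms
proof (induction I rule: finite_induct)
  case (insert i I)
  have "(f i + sum f I) powr s \<le> f i powr s + sum f I powr s"
    using insert by (intro powr_add_le sum_nonneg) auto
  with insert show ?case by fastforce
qed auto

section \<open>Lengths of interval covers and packings through Lebesgue measure\<close>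

lemma interval_cover_length:
  fixes l u :: "'a \<Rightarrow> real"
  assumes "finite I" "\<And>i. i \<in> I \<Longrightarrow> l i \<le> u i" "{a..b} \<subseteq> (\<Union>i\<in>I. {l i..u i})"
  shows "b - a \<le> (\<Sum>i\<in>I. u i - l i)"
proof (cases "a \<le> b")
  case True
  have "b - a = measure lebesgue {a..b}" using True by simp
  also have "\<dots> \<le> measure lebesgue (\<Union>i\<in>I. {l i..u i})"
    by (rule measure_mono_fmeasurable) (use assms in \<open>auto intro!: fmeasurable.finite_UN\<close>)
  also have "\<dots> \<le> (\<Sum>i\<in>I. measure lebesgue {l i..u i})"
    by (rule measure_UNION_le) (use assms in auto)
  also have "\<dots> = (\<Sum>i\<in>I. u i - l i)" using assms by (intro sum.cong) auto
  finally show ?thesis .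
next
  case False
  have "0 \<le> (\<Sum>i\<in>I. u i - l i)" using assms by (intro sum_nonneg) auto
  then show ?thesis using False by linarith
qed

text \<open>Disjointness is asked of the open intervals only, so neighbouring intervals may share an
  endpoint.\<close>

lemma interval_packing_length:
  fixes l u :: "'a \<Rightarrow> real"
  assumes "finite I" "\<And>i. i \<in> I \<Longrightarrow> l i \<le> u i" "\<And>i. i \<in> I \<Longrightarrow> a \<le> l i \<and> u i \<le> b"
    "disjoint_family_on (\<lambda>i. {l i<..<u i}) I" "a \<le> b"
  shows "(\<Sum>i\<in>I. u i - l i) \<le> b - a"
proof -
  have "(\<Sum>i\<in>I. u i - l i) = (\<Sum>i\<in>I. measure lebesgue {l i<..<u i})"
    using assms by (intro sum.cong) auto
  also have "\<dots> = measure lebesgue (\<Union>i\<in>I. {l i<..<u i})"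
    by (rule measure_finite_Union[symmetric])
      (use assms in \<open>auto simp: emeasure_lborel_Ioo\<close>)
  also have "\<dots> \<le> measure lebesgue {a..b}"
  proof (rule measure_mono_fmeasurable)
    show "(\<Union>i\<in>I. {l i<..<u i}) \<subseteq> {a..b}"
      using assms(3) by (force dest: less_imp_le order_trans)
  qed (use assms(1) in \<open>auto intro!: sets.finite_UN\<close>)
  also have "\<dots> = b - a" using assms by simp
  finally show ?thesis .
qed

section \<open>Mean, squared deviation and spread of a finite family\<close>

definition mean :: "('a \<Rightarrow> real) \<Rightarrow> 'a set \<Rightarrow> real" where
  "mean y S = (\<Sum>i\<in>S. y i) / real (card S)"

definition sqdev :: "('a \<Rightarrow> real) \<Rightarrow> 'a set \<Rightarrow> real" where
  "sqdev y S = (\<Sum>i\<in>S. (y i - mean y S)\<^sup>2)"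

definition spread :: "('a \<Rightarrow> real) \<Rightarrow> 'a set \<Rightarrow> real" where
  "spread y S = Max (y ` S) - Min (y ` S)"

lemma sqdev_nonneg: "0 \<le> sqdev y S"
  unfolding sqdev_def by (simp add: sum_nonneg)

text \<open>The parallel-axis identity; it shows that the mean is the best centre.\<close>

lemma sum_sq_diff_eq_sqdev:
  assumes "finite S"
  shows "(\<Sum>i\<in>S. (y i - c)\<^sup>2) = sqdev y S + real (card S) * (mean y S - c)\<^sup>2"
proof (cases "S = {}")
  case False
  then have card: "real (card S) > 0" using assms by (simp add: card_gt_0_iff)
  let ?\<mu> = "mean y S"
  have sum: "(\<Sum>i\<in>S. y i) = real (card S) * ?\<mu>" using card by (simp add: mean_def)
  have "(\<Sum>i\<in>S. (y i - c)\<^sup>2) = (\<Sum>i\<in>S. (y i - ?\<mu>)\<^sup>2 + (2 * (?\<mu> - c)) * y i + (c\<^sup>2 - ?\<mu>\<^sup>2))"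
    by (intro sum.cong) (auto simp: power2_eq_square algebra_simps)
  also have "\<dots> = sqdev y S + 2 * (?\<mu> - c) * (\<Sum>i\<in>S. y i) + real (card S) * (c\<^sup>2 - ?\<mu>\<^sup>2)"
    by (simp add: sum.distrib sqdev_def sum_distrib_left)
  also have "\<dots> = sqdev y S + real (card S) * (?\<mu> - c)\<^sup>2"
    unfolding sum by (simp add: power2_eq_square algebra_simps)
  finally show ?thesis .
qed (simp add: sqdev_def)

lemma sqdev_le_sum_sq_diff: "finite S \<Longrightarrow> sqdev y S \<le> (\<Sum>i\<in>S. (y i - c)\<^sup>2)"
  by (simp add: sum_sq_diff_eq_sqdev)

text \<open>The mean of \<open>L\<close> is a better centre for \<open>L\<close> than the mean of
  \<open>S\<close>, and the terms outside \<open>L\<close> are nonnegative. Through this a subsystem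
  inherits the potential bound of the whole.\<close>

lemma sqdev_mono:
  assumes "finite S" "L \<subseteq> S"
  shows "sqdev y L \<le> sqdev y S"
proof -
  have "sqdev y L \<le> (\<Sum>i\<in>L. (y i - mean y S)\<^sup>2)"
    using assms finite_subset by (intro sqdev_le_sum_sq_diff) auto
  also have "\<dots> \<le> sqdev y S" unfolding sqdev_def using assms by (intro sum_mono2) auto
  finally show ?thesis .
qed

lemma diff_le_spread:
  assumes "finite K" "i \<in> K" "j \<in> K"
  shows "y i - y j \<le> spread y K"
  unfolding spread_def using assms by (intro diff_mono Max_ge Min_le) auto

lemma spread_attained:
  assumes "finite K" "K \<noteq> {}"
  obtains i j where "i \<in> K" "j \<in> K" "Max (y ` K) = y i" "Min (y ` K) = y j"
  using assms Max_in[of "y ` K"] Min_in[of "y ` K"] by (auto simp: image_iff)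

lemma spread_nonneg: "finite K \<Longrightarrow> K \<noteq> {} \<Longrightarrow> 0 \<le> spread y K"
  using diff_le_spread[of K _ _ y] by (metis all_not_in_conv diff_self)

text \<open>Only the two points attaining the maximum and the minimum matter; the factor 2 is that
  of \<open>(u - v)^2 <= 2 * (u^2 + v^2)\<close>.\<close>

lemma spread_sq_le_sqdev:
  assumes "finite K" "K \<noteq> {}"
  shows "(spread y K)\<^sup>2 \<le> 2 * sqdev y K"
proof -
  obtain i j where ij: "i \<in> K" "j \<in> K" "spread y K = y i - y j"
    by (metis spread_attained[OF assms] spread_def)
  show ?thesis
  proof (cases "i = j")
    case False
    let ?\<mu> = "mean y K"
    have "(spread y K)\<^sup>2 \<le> 2 * ((y i - ?\<mu>)\<^sup>2 + (y j - ?\<mu>)\<^sup>2)"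
      using zero_le_power2[of "(y i - ?\<mu>) + (y j - ?\<mu>)"]
      unfolding ij(3) by (simp add: power2_eq_square algebra_simps)
    also have "\<dots> = 2 * (\<Sum>k\<in>{i, j}. (y k - ?\<mu>)\<^sup>2)" using False by simp
    also have "\<dots> \<le> 2 * sqdev y K"
      unfolding sqdev_def using ij assms by (intro mult_left_mono sum_mono2) auto
    finally show ?thesis .
  qed (use ij sqdev_nonneg in auto)
qed

text \<open>Each deviation from the minimum is at most the spread. The factor \<open>card S\<close>
  becomes the \<open>n\<close> in the bound for several components.\<close>

lemma sqdev_le_spread_sq:
  assumes "finite S" "S \<noteq> {}"
  shows "sqdev y S \<le> real (card S) * (spread y S)\<^sup>2"
proof -
  obtain j where j: "j \<in> S" "Min (y ` S) = y j" by (rule spread_attained[OF assms])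
  have "sqdev y S \<le> (\<Sum>i\<in>S. (y i - y j)\<^sup>2)" by (rule sqdev_le_sum_sq_diff[OF assms(1)])
  also have "\<dots> \<le> (\<Sum>i\<in>S. (spread y S)\<^sup>2)"
  proof (intro sum_mono power_mono)
    fix i assume "i \<in> S"
    then show "y i - y j \<le> spread y S" using assms j by (intro diff_le_spread)
    have "Min (y ` S) \<le> y i" using assms \<open>i \<in> S\<close> by simp
    then show "0 \<le> y i - y j" using j by simp
  qed
  finally show ?thesis by simp
qed

subsection \<open>Cheeger's inequality\<close>

text \<open>A layer-cake argument that peels off one level at a time. Lowering \<open>f\<close> by
  its least positive value \<open>a\<close> on its support \<open>X\<close> lowers the left side by
  \<open>a * h * card X\<close> and the edge sum by \<open>a\<close> for every edge leaving
  \<open>X\<close>. The support shrinks, so it stays within half of \<open>K\<close>.\<close>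

lemma coarea_expansion:
  fixes f :: "'a \<Rightarrow> real" and h :: real
  assumes K: "finite K" "E \<subseteq> K \<times> K"
    and expansion: "\<And>X. X \<subseteq> K \<Longrightarrow> 2 * card X \<le> card K \<Longrightarrow>
      h * real (card X) \<le> real (card {(i, j) \<in> E. i \<in> X \<and> j \<notin> X})"
    and "\<And>i. i \<in> K \<Longrightarrow> 0 \<le> f i" "2 * card {i \<in> K. 0 < f i} \<le> card K"
  shows "h * (\<Sum>i\<in>K. f i) \<le> (\<Sum>(i, j)\<in>E. max 0 (f i - f j))"
  using assms(4,5)
proof (induction "card {i \<in> K. 0 < f i}" arbitrary: f rule: less_induct)
  case less
  define X where "X = {i \<in> K. 0 < f i}"
  have fin: "finite X" "finite E" using K finite_subset[OF K(2)] by (auto simp: X_def)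
  have out: "f i = 0" if "i \<in> K" "i \<notin> X" for i
    using that less.prems(1)[of i] by (auto simp: X_def)
  show ?case
  proof (cases "X = {}")
    case True
    then have "(\<Sum>i\<in>K. f i) = 0" using out by (intro sum.neutral) auto
    moreover have "0 \<le> (\<Sum>(i, j)\<in>E. max 0 (f i - f j))" by (intro sum_nonneg) auto
    ultimately show ?thesis by simp
  next
    case False
    define a where "a = Min (f ` X)"
    have "a \<in> f ` X" unfolding a_def using False fin by (intro Min_in) auto
    then obtain k where k: "k \<in> X" "a = f k" by auto
    have a_le: "a \<le> f i" if "i \<in> X" for i using that fin by (simp add: a_def)
    have a_pos: "0 < a" using k by (simp add: X_def)
    define g where "g i = (if i \<in> X then f i - a else f i)" for i
    have g_nonneg: "0 \<le> g i" if "i \<in> K" for i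
      using that a_le less.prems(1) by (auto simp: g_def)
    have "{i \<in> K. 0 < g i} \<subset> X"
    proof
      show "{i \<in> K. 0 < g i} \<subseteq> X" using a_pos by (auto simp: g_def X_def split: if_splits)
      show "{i \<in> K. 0 < g i} \<noteq> X" using k by (auto simp: g_def)
    qed
    then have smaller: "card {i \<in> K. 0 < g i} < card X" by (rule psubset_card_mono[OF fin(1)])
    have IH: "h * (\<Sum>i\<in>K. g i) \<le> (\<Sum>(i, j)\<in>E. max 0 (g i - g j))"
      by (rule less.hyps) (use smaller less.prems(2) g_nonneg in \<open>auto simp: X_def\<close>)
    have "(\<Sum>i\<in>K. f i) = (\<Sum>i\<in>K. g i + (if i \<in> X then a else 0))"
      by (intro sum.cong) (auto simp: g_def)
    also have "\<dots> = (\<Sum>i\<in>K. g i) + a * real (card X)"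
    proof -
      have "(\<Sum>i\<in>K. if i \<in> X then a else 0) = (\<Sum>i\<in>K \<inter> X. a)"
        using K by (intro sum.inter_restrict[symmetric])
      also have "K \<inter> X = X" by (auto simp: X_def)
      finally show ?thesis by (simp add: sum.distrib)
    qed
    finally have "h * (\<Sum>i\<in>K. f i) = h * (\<Sum>i\<in>K. g i) + a * (h * real (card X))"
      by (simp add: algebra_simps)
    also have "\<dots> \<le> (\<Sum>(i, j)\<in>E. max 0 (g i - g j)) + a * real (card {(i, j) \<in> E. i \<in> X \<and> j \<notin> X})"
      using less.prems(2) a_pos by (intro add_mono IH mult_left_mono expansion) (auto simp: X_def)
    also have "\<dots> = (\<Sum>(i, j)\<in>E. max 0 (g i - g j) + (if i \<in> X \<and> j \<notin> X then a else 0))"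
    proof -
      have "a * real (card {(i, j) \<in> E. i \<in> X \<and> j \<notin> X}) = (\<Sum>p\<in>{p \<in> E. fst p \<in> X \<and> snd p \<notin> X}. a)"
        by (simp add: case_prod_unfold)
      also have "\<dots> = (\<Sum>p\<in>E. if fst p \<in> X \<and> snd p \<notin> X then a else 0)"
        using fin by (intro sum.inter_filter)
      finally show ?thesis by (simp add: sum.distrib case_prod_beta)
    qed
    also have "\<dots> = (\<Sum>(i, j)\<in>E. max 0 (f i - f j))"
    proof (intro sum.cong refl, clarify)
      fix i j assume "(i, j) \<in> E"
      then have ij: "i \<in> K" "j \<in> K" using K by auto
      show "max 0 (g i - g j) + (if i \<in> X \<and> j \<notin> X then a else 0) = max 0 (f i - f j)"
        using ij out[of i] out[of j] a_le[of i] a_le[of j] g_nonneg[of j] a_pos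
        by (auto simp: g_def max_def)
    qed
    finally show ?thesis .
  qed
qed

text \<open>Models one connected component. \<open>E\<close> contains both orientations of every
  edge, and a boundary is counted in the outward orientation, so each undirected boundary edge
  counts once.\<close>

locale expander =
  fixes K :: "'a set" and E :: "('a \<times> 'a) set" and h :: real and d :: nat
  assumes finite_K: "finite K" and E_sub: "E \<subseteq> K \<times> K" and sym_E: "sym E"
    and h_nonneg: "0 \<le> h"
    and degree: "\<And>i. i \<in> K \<Longrightarrow> card (E `` {i}) = d"
    and expansion: "\<And>X. X \<subseteq> K \<Longrightarrow> 2 * card X \<le> card K \<Longrightarrow>
      h * real (card X) \<le> real (card {(i, j) \<in> E. i \<in> X \<and> j \<notin> X})"
begin

lemma finite_E: "finite E"
  using finite_K E_sub by (meson finite_SigmaI finite_subset)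

lemma sum_swap: "(\<Sum>(i, j)\<in>E. F j i) = (\<Sum>(i, j)\<in>E. F i j)" for F :: "'a \<Rightarrow> 'a \<Rightarrow> real"
  by (rule sum.reindex_bij_witness[where i = prod.swap and j = prod.swap])
    (use sym_E in \<open>auto simp: sym_def\<close>)

lemma sum_fst: "(\<Sum>(i, j)\<in>E. F i) = real d * (\<Sum>i\<in>K. F i)" for F :: "'a \<Rightarrow> real"
proof -
  have E: "E = Sigma K (\<lambda>i. E `` {i})" using E_sub by auto
  have "finite (E `` {i})" for i using finite_E by (rule finite_Image)
  then have "(\<Sum>(i, j)\<in>E. F i) = (\<Sum>i\<in>K. \<Sum>j\<in>E `` {i}. F i)"
    by (subst E, subst sum.Sigma) (use finite_K in auto)
  also have "\<dots> = real d * (\<Sum>i\<in>K. F i)"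
    using degree by (simp add: sum_distrib_left)
  finally show ?thesis .
qed

text \<open>The co-area bound is applied to the squares of \<open>g\<close>; their differences
  factor as \<open>(g i - g j) * (g i + g j)\<close>, and Cauchy-Schwarz separates the two factors.
  The sums \<open>g i + g j\<close> contribute at most \<open>4 * d * Q\<close>.\<close>

lemma half_support_poincare:
  fixes g :: "'a \<Rightarrow> real"
  assumes "\<And>i. i \<in> K \<Longrightarrow> 0 \<le> g i" "2 * card {i \<in> K. 0 < g i} \<le> card K"
  shows "h\<^sup>2 * (\<Sum>i\<in>K. (g i)\<^sup>2) \<le> real d * (\<Sum>(i, j)\<in>E. (g i - g j)\<^sup>2)"
proof (cases "(\<Sum>i\<in>K. (g i)\<^sup>2) = 0")
  case True
  have "0 \<le> (\<Sum>(i, j)\<in>E. (g i - g j)\<^sup>2)" by (intro sum_nonneg) auto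
  with True show ?thesis by simp
next
  case False
  define Q where "Q = (\<Sum>i\<in>K. (g i)\<^sup>2)"
  define D where "D = (\<Sum>(i, j)\<in>E. (g i - g j)\<^sup>2)"
  define W where "W = (\<Sum>(i, j)\<in>E. \<bar>g i - g j\<bar> * \<bar>g i + g j\<bar>)"
  have "Q \<ge> 0" unfolding Q_def by (intro sum_nonneg) auto
  with False have Q: "Q > 0" by (simp add: Q_def)
  have "{i \<in> K. 0 < (g i)\<^sup>2} = {i \<in> K. 0 < g i}" using assms(1) by force
  then have "h * Q \<le> (\<Sum>(i, j)\<in>E. max 0 ((g i)\<^sup>2 - (g j)\<^sup>2))"
    unfolding Q_def by (intro coarea_expansion[OF finite_K E_sub expansion]) (use assms(2) in auto)
  \<comment> \<open>Adding the bound for reversed edges replaces positive parts by absolute values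
    and gains the factor 2 that cancels the 4 below.\<close>
  moreover have "h * Q \<le> (\<Sum>(i, j)\<in>E. max 0 ((g j)\<^sup>2 - (g i)\<^sup>2))"
    using calculation sum_swap[of "\<lambda>i j. max 0 ((g i)\<^sup>2 - (g j)\<^sup>2)"] by simp
  ultimately have "2 * (h * Q) \<le>
      (\<Sum>(i, j)\<in>E. max 0 ((g i)\<^sup>2 - (g j)\<^sup>2) + max 0 ((g j)\<^sup>2 - (g i)\<^sup>2))"
    by (simp add: sum.distrib case_prod_beta)
  also have "\<dots> = W"
    unfolding W_def
  proof (intro sum.cong refl, clarify)
    fix i j
    have "max 0 ((g i)\<^sup>2 - (g j)\<^sup>2) + max 0 ((g j)\<^sup>2 - (g i)\<^sup>2) = \<bar>(g i)\<^sup>2 - (g j)\<^sup>2\<bar>" by auto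
    also have "\<bar>(g i)\<^sup>2 - (g j)\<^sup>2\<bar> = \<bar>(g i - g j) * (g i + g j)\<bar>"
      by (simp add: power2_eq_square algebra_simps)
    finally show "max 0 ((g i)\<^sup>2 - (g j)\<^sup>2) + max 0 ((g j)\<^sup>2 - (g i)\<^sup>2) = \<bar>g i - g j\<bar> * \<bar>g i + g j\<bar>"
      by (simp add: abs_mult)
  qed
  finally have "(2 * (h * Q))\<^sup>2 \<le> W\<^sup>2"
    using h_nonneg Q by (intro power_mono) auto
  also have "\<dots> \<le> D * (\<Sum>(i, j)\<in>E. (g i + g j)\<^sup>2)"
    using Cauchy_Schwarz_ineq_sum[of "\<lambda>(i, j). \<bar>g i - g j\<bar>" "\<lambda>(i, j). \<bar>g i + g j\<bar>" E]
    unfolding W_def D_def by (simp add: case_prod_beta)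
  also have "\<dots> \<le> D * (4 * real d * Q)"
  proof (intro mult_left_mono)
    have "(\<Sum>(i, j)\<in>E. (g i + g j)\<^sup>2) \<le> (\<Sum>(i, j)\<in>E. 2 * (g i)\<^sup>2 + 2 * (g j)\<^sup>2)"
    proof (intro sum_mono, clarify)
      fix i j
      show "(g i + g j)\<^sup>2 \<le> 2 * (g i)\<^sup>2 + 2 * (g j)\<^sup>2"
        using zero_le_power2[of "g i - g j"] by (simp add: power2_eq_square algebra_simps)
    qed
    also have "\<dots> = (\<Sum>(i, j)\<in>E. 2 * (g i)\<^sup>2) + (\<Sum>(i, j)\<in>E. 2 * (g j)\<^sup>2)"
      by (simp add: sum.distrib case_prod_beta)
    also have "\<dots> = 4 * real d * Q"
      using sum_swap[of "\<lambda>i j. 2 * (g i)\<^sup>2"] sum_fst[of "\<lambda>i. 2 * (g i)\<^sup>2"]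
      by (simp add: Q_def flip: sum_distrib_left)
    finally show "(\<Sum>(i, j)\<in>E. (g i + g j)\<^sup>2) \<le> 4 * real d * Q" .
    show "0 \<le> D" unfolding D_def by (intro sum_nonneg) auto
  qed
  finally have "(h\<^sup>2 * Q) * Q \<le> (real d * D) * Q"
    by (simp add: power2_eq_square algebra_simps)
  then have "h\<^sup>2 * Q \<le> real d * D" using Q by simp
  then show ?thesis by (simp add: Q_def D_def)
qed

end

lemma median_exists:
  fixes y :: "'a \<Rightarrow> real"
  assumes "finite K" "K \<noteq> {}"
  obtains c where "2 * card {i \<in> K. c < y i} \<le> card K" "2 * card {i \<in> K. y i < c} \<le> card K"
proof -
  \<comment> \<open>The median is the least attained value with at most half of the points strictly
    above it.\<close>
  define A where "A = {v \<in> y ` K. 2 * card {i \<in> K. v < y i} \<le> card K}"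
  have "{i \<in> K. Max (y ` K) < y i} = {}" using assms by (auto simp: not_less)
  then have "2 * card {i \<in> K. Max (y ` K) < y i} \<le> card K" by (simp only: card.empty)
  moreover have "Max (y ` K) \<in> y ` K" using assms by (intro Max_in) auto
  ultimately have "Max (y ` K) \<in> A" unfolding A_def by blast
  moreover have fA: "finite A" using assms by (simp add: A_def)
  ultimately have c: "Min A \<in> A" by (intro Min_in) auto
  have "2 * card {i \<in> K. y i < Min A} \<le> card K"
  proof (cases "{i \<in> K. y i < Min A} = {}")
    case False
    \<comment> \<open>The largest value \<open>y k\<close> below the candidate fails the test, so
      more than half of the points lie strictly above it. These points form exactly the complement
      of \<open>B\<close>.\<close>
    define B where "B = {i \<in> K. y i < Min A}"
    have B: "finite B" "B \<noteq> {}" using assms False by (auto simp: B_def)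
    obtain k where k: "k \<in> B" "Max (y ` B) = y k" by (rule spread_attained[OF B])
    have above: "{i \<in> K. y k < y i} = K - B"
    proof -
      have "y i \<le> y k" if "i \<in> B" for i using that B by (simp flip: k(2))
      moreover have "y k < y i" if "i \<in> K - B" for i using that k by (auto simp: B_def)
      ultimately show ?thesis by (auto simp: not_le[symmetric])
    qed
    have "y k \<notin> A" using Min_le[OF fA, of "y k"] k by (auto simp: B_def)
    moreover have "k \<in> K" "B \<subseteq> K" using k by (auto simp: B_def)
    ultimately have "card K < 2 * card (K - B)" by (auto simp: A_def above)
    also have "card (K - B) = card K - card B" using B \<open>B \<subseteq> K\<close> by (simp add: card_Diff_subset)
    finally show ?thesis unfolding B_def by linarith
  next
    case True
    then show ?thesis by (simp only: card.empty)
  qed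
  with c show ?thesis using that by (auto simp: A_def)
qed

context expander
begin

text \<open>Centring at a median makes the supports of the positive and the negative part at most
  half of \<open>K\<close>, so the half-support bound applies to each. Passing from the mean to the
  median only enlarges the left side.\<close>

lemma cheeger_inequality:
  fixes y :: "'a \<Rightarrow> real"
  shows "h\<^sup>2 * sqdev y K \<le> real d * (\<Sum>(i, j)\<in>E. (y i - y j)\<^sup>2)"
proof (cases "K = {}")
  case True
  then show ?thesis using E_sub by (simp add: sqdev_def)
next
  case False
  obtain c where c: "2 * card {i \<in> K. c < y i} \<le> card K" "2 * card {i \<in> K. y i < c} \<le> card K"
    by (rule median_exists[OF finite_K False])
  define u v where "u i = max 0 (y i - c)" and "v i = max 0 (c - y i)" for i
  have "h\<^sup>2 * sqdev y K \<le> h\<^sup>2 * (\<Sum>i\<in>K. (y i - c)\<^sup>2)"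
    by (intro mult_left_mono sqdev_le_sum_sq_diff finite_K) auto
  also have "(\<Sum>i\<in>K. (y i - c)\<^sup>2) = (\<Sum>i\<in>K. (u i)\<^sup>2) + (\<Sum>i\<in>K. (v i)\<^sup>2)"
    unfolding sum.distrib[symmetric]
    by (intro sum.cong) (auto simp: u_def v_def max_def power2_commute)
  also have "h\<^sup>2 * \<dots> = h\<^sup>2 * (\<Sum>i\<in>K. (u i)\<^sup>2) + h\<^sup>2 * (\<Sum>i\<in>K. (v i)\<^sup>2)"
    by (simp add: distrib_left)
  also have "\<dots> \<le> real d * (\<Sum>(i, j)\<in>E. (u i - u j)\<^sup>2) + real d * (\<Sum>(i, j)\<in>E. (v i - v j)\<^sup>2)"
    using c by (intro add_mono half_support_poincare) (auto simp: u_def v_def less_max_iff_disj)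
  also have "\<dots> = real d * (\<Sum>(i, j)\<in>E. (u i - u j)\<^sup>2 + (v i - v j)\<^sup>2)"
    by (simp add: sum.distrib case_prod_beta distrib_left)
  also have "\<dots> \<le> real d * (\<Sum>(i, j)\<in>E. (y i - y j)\<^sup>2)"
  proof (intro mult_left_mono sum_mono, clarify)
    fix i j
    \<comment> \<open>\<open>u\<close> is nondecreasing and \<open>v\<close> nonincreasing in
      \<open>y\<close>, so the cross term has the favourable sign.\<close>
    have "0 \<le> (u i - u j) * (v j - v i)"
      unfolding u_def v_def by (cases "y i \<le> y j") (auto intro: mult_nonneg_nonneg mult_nonpos_nonpos)
    moreover have yuv: "y i - y j = (u i - u j) + (v j - v i)" by (auto simp: u_def v_def)
    have "(y i - y j)\<^sup>2 = (u i - u j)\<^sup>2 + (v i - v j)\<^sup>2 + 2 * ((u i - u j) * (v j - v i))"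
      unfolding yuv by (simp add: power2_eq_square algebra_simps)
    ultimately show "(u i - u j)\<^sup>2 + (v i - v j)\<^sup>2 \<le> (y i - y j)\<^sup>2" by linarith
  qed simp
  finally show ?thesis .
qed

end

subsection \<open>Blocks of a graph on the line\<close>

locale expander_graph =
  fixes n d :: nat and h :: real and G :: "nat \<Rightarrow> nat \<Rightarrow> bool"
  assumes reg: "regular_loop_graph n d G" and cheeger: "cheeger_at_least n G h"
    and d_ge_2: "2 \<le> d" and h_pos: "0 < h"
begin

lemma edge_less: "G i j \<Longrightarrow> i < n \<and> j < n"
  and edge_sym: "G i j \<Longrightarrow> G j i"
  and loop: "i < n \<Longrightarrow> G i i"
  and degree_eq: "i < n \<Longrightarrow> card {j. j < n \<and> G i j} = d"
  using reg unfolding regular_loop_graph_def by blast+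

section \<open>Connected components of one graph\<close>

lemma reach_sym: "G\<^sup>*\<^sup>* i j \<Longrightarrow> G\<^sup>*\<^sup>* j i"
  by (metis edge_sym sympI symp_rtranclp sympD)

lemma component_props:
  assumes "K \<in> graph_components n G"
  shows component_subset: "K \<subseteq> {..<n}" and component_nonempty: "K \<noteq> {}"
    and component_finite: "finite K"
    and component_closed: "\<And>i j. i \<in> K \<Longrightarrow> G i j \<Longrightarrow> j \<in> K"
    and component_reach: "\<And>i j. i \<in> K \<Longrightarrow> j \<in> K \<Longrightarrow> G\<^sup>*\<^sup>* i j"
proof -
  obtain k where k: "k < n" "K = {j. j < n \<and> G\<^sup>*\<^sup>* k j}"
    using assms by (auto simp: graph_components_def)
  show "K \<subseteq> {..<n}" "K \<noteq> {}" "finite K" using k by auto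
  show "j \<in> K" if "i \<in> K" "G i j" for i j
    using that k edge_less by (auto intro: rtranclp.rtrancl_into_rtrancl)
  show "G\<^sup>*\<^sup>* i j" if "i \<in> K" "j \<in> K" for i j
    using that k reach_sym by (auto intro: rtranclp_trans)
qed

lemma reach_closed:
  assumes "G\<^sup>*\<^sup>* i j" "i \<in> S" "\<And>i j. i \<in> S \<Longrightarrow> G i j \<Longrightarrow> j \<in> S"
  shows "j \<in> S"
  using assms(1,2) by induction (use assms(3) in auto)

lemma component_subset_of_closed:
  assumes "K \<in> graph_components n G" "i \<in> K" "i \<in> S" "\<And>i j. i \<in> S \<Longrightarrow> G i j \<Longrightarrow> j \<in> S"
  shows "K \<subseteq> S"
  using assms reach_closed component_reach by blast

lemma component_unique:
  assumes "K \<in> graph_components n G" "K' \<in> graph_components n G" "i \<in> K" "i \<in> K'"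
  shows "K = K'"
  using assms component_subset_of_closed component_closed by (metis subset_antisym)

lemma component_exists: "i < n \<Longrightarrow> \<exists>K\<in>graph_components n G. i \<in> K"
  by (auto simp: graph_components_def)

lemma finite_components: "finite (graph_components n G)"
  by (simp add: graph_components_def)

lemma component_crossing_edge:
  assumes "K \<in> graph_components n G" "a \<in> K" "a \<in> L" "b \<in> K" "b \<notin> L"
  shows "\<exists>i\<in>K \<inter> L. \<exists>j\<in>K - L. G i j"
proof (rule ccontr)
  assume neg: "\<not> ?thesis"
  have closed: "j \<in> K \<inter> L" if "i \<in> K \<inter> L" "G i j" for i j
    using that neg component_closed[OF assms(1), of i j] by blast
  have "b \<in> K \<inter> L"
    by (rule reach_closed[OF component_reach[OF assms(1,2,4)] _ closed])
      (use assms in auto)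
  then show False using assms by blast
qed

text \<open>Since \<open>d\<close> is at least 2, the loop is not the only neighbour. Hence no
  component is a singleton.\<close>

lemma proper_neighbour:
  assumes "i < n"
  obtains j where "j \<noteq> i" "G i j"
proof -
  have "\<not> {j. j < n \<and> G i j} \<subseteq> {i}"
    using degree_eq[OF assms] d_ge_2 card_mono[of "{i}" "{j. j < n \<and> G i j}"] by auto
  then show ?thesis using that by blast
qed

lemma component_expander:
  assumes K: "K \<in> graph_components n G"
  shows "expander K {(i, j). i \<in> K \<and> G i j} h d"
proof
  show "card ({(i, j). i \<in> K \<and> G i j} `` {i}) = d" if "i \<in> K" for i
  proof -
    have "{(i, j). i \<in> K \<and> G i j} `` {i} = {j. j < n \<and> G i j}"
      using that edge_less by auto
    then show ?thesis using that component_subset[OF K] degree_eq by auto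
  qed
  show "h * real (card X) \<le> real (card {(i, j) \<in> {(i, j). i \<in> K \<and> G i j}. i \<in> X \<and> j \<notin> X})"
    if "X \<subseteq> K" "2 * card X \<le> card K" for X
  proof -
    have "{(i, j) \<in> {(i, j). i \<in> K \<and> G i j}. i \<in> X \<and> j \<notin> X} = {(i, j). i \<in> X \<and> j < n \<and> j \<notin> X \<and> G i j}"
      using that edge_less by auto
    then show ?thesis using that cheeger K unfolding cheeger_at_least_def by auto
  qed
  show "{(i, j). i \<in> K \<and> G i j} \<subseteq> K \<times> K" using component_closed[OF K] by auto
  show "sym {(i, j). i \<in> K \<and> G i j}" using component_closed[OF K] edge_sym by (auto intro: symI)
qed (use component_finite[OF K] h_pos in auto)

text \<open>Cheeger's condition is tested on a single vertex, which is at most half of its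
  component. The resulting bound on \<open>h\<close> keeps the contraction factors below in
  [0,1].\<close>

lemma h_le_d:
  assumes "K \<in> graph_components n G"
  shows "h \<le> real d"
proof -
  interpret expander K "{(i, j). i \<in> K \<and> G i j}" h d by (rule component_expander[OF assms])
  obtain i where i: "i \<in> K" using component_nonempty[OF assms] by blast
  then obtain j where j: "j \<noteq> i" "G i j"
    using proper_neighbour component_subset[OF assms] by blast
  have "card {i, j} \<le> card K"
    using i j component_closed[OF assms] by (intro card_mono finite_K) auto
  then have "h * real (card {i}) \<le> real (card {(a, b) \<in> {(i, j). i \<in> K \<and> G i j}. a \<in> {i} \<and> b \<notin> {i}})"
    using i j by (intro expansion) auto
  also have "\<dots> \<le> real (card (Pair i ` {j. j < n \<and> G i j}))"
    using edge_less by (intro of_nat_mono card_mono) auto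
  also have "\<dots> = real d" using i component_subset[OF assms] degree_eq by (auto simp: card_image inj_on_def)
  finally show ?thesis by simp
qed

lemma h_sq_le_d_cube:
  assumes "K \<in> graph_components n G"
  shows "h\<^sup>2 \<le> real d ^ 3"
proof -
  have "h\<^sup>2 \<le> (real d)\<^sup>2" using h_le_d[OF assms] h_pos by (intro power_mono) auto
  also have "\<dots> \<le> real d ^ 3" using d_ge_2 by (intro power_increasing) auto
  finally show ?thesis .
qed

text \<open>For \<open>p\<close> between the extreme values of a component, the cut at
  \<open>p\<close> separates two of its vertices, so some edge crosses the cut and its interval
  contains \<open>p\<close>.\<close>

lemma edge_union_eq:
  "edge_union n G y = (\<Union>K\<in>graph_components n G. {Min (y ` K)..Max (y ` K)})"
proof (intro equalityI subsetI)
  fix p assume "p \<in> edge_union n G y"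
  then obtain i j where ij: "i < n" "G i j" "min (y i) (y j) \<le> p" "p \<le> max (y i) (y j)"
    by (auto simp: edge_union_def)
  obtain K where K: "K \<in> graph_components n G" "i \<in> K" using component_exists ij by blast
  have mem: "i \<in> K" "j \<in> K" using K ij component_closed[OF K(1)] by auto
  have "Min (y ` K) \<le> min (y i) (y j)" "max (y i) (y j) \<le> Max (y ` K)"
    using mem component_finite[OF K(1)] by auto
  then have "p \<in> {Min (y ` K)..Max (y ` K)}" using ij by auto
  then show "p \<in> (\<Union>K\<in>graph_components n G. {Min (y ` K)..Max (y ` K)})" using K by blast
next
  fix p assume "p \<in> (\<Union>K\<in>graph_components n G. {Min (y ` K)..Max (y ` K)})"
  then obtain K where K: "K \<in> graph_components n G" "Min (y ` K) \<le> p" "p \<le> Max (y ` K)" by auto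
  have edge: "p \<in> edge_union n G y" if "i \<noteq> j" "G i j" "y i \<le> p" "p \<le> y j" for i j
    unfolding edge_union_def
  proof
    show "p \<in> {min (y i) (y j)..max (y i) (y j)}" using that by auto
    show "{min (y i) (y j)..max (y i) (y j)} \<in>
      {{min (y i) (y j)..max (y i) (y j)} |i j. i < n \<and> j < n \<and> i \<noteq> j \<and> G i j}"
      using that edge_less by blast
  qed
  obtain b a where ab: "b \<in> K" "a \<in> K" "Max (y ` K) = y b" "Min (y ` K) = y a"
    by (rule spread_attained[OF component_finite[OF K(1)] component_nonempty[OF K(1)]])
  show "p \<in> edge_union n G y"
  proof (cases "p = y b")
    \<comment> \<open>At the maximum the cut no longer separates anything; an edge from the top
      vertex to a proper neighbour covers this point instead.\<close>
    case True
    obtain j where j: "j \<noteq> b" "G b j"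
      using proper_neighbour ab component_subset[OF K(1)] by blast
    then have "y j \<le> y b"
      using ab component_closed[OF K(1)] component_finite[OF K(1)] by (simp flip: ab(3))
    then show ?thesis using edge[of j b] j True edge_sym by auto
  next
    case False
    then have "a \<in> {i. y i \<le> p}" "b \<notin> {i. y i \<le> p}" using K ab by auto
    then obtain i j where "y i \<le> p" "\<not> y j \<le> p" "G i j"
      using component_crossing_edge[OF K(1) ab(2) _ ab(1), of "{i. y i \<le> p}"] by auto
    then show ?thesis by (intro edge[of i j]) auto
  qed
qed

text \<open>A block is a union of intervals spanned by graph components, so its length is at most
  the sum of their spreads, and subadditivity of the \<open>s\<close>-th power distributes over this
  sum.\<close>

lemma block_energy_le:
  assumes s: "0 < s" "s \<le> 1"
  shows "block_energy s n G y \<le> (\<Sum>K\<in>graph_components n G. spread y K powr s)"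
proof -
  define J where "J K = {Min (y ` K)..Max (y ` K)}" for K
  define U where "U = edge_union n G y"
  define \<C> where "\<C> = graph_components n G"
  define c where "c K = connected_component_set U (Min (y ` K))" for K
  have U: "U = (\<Union>K\<in>\<C>. J K)" by (simp add: U_def J_def \<C>_def edge_union_eq)
  have le: "Min (y ` K) \<le> Max (y ` K)" if "K \<in> \<C>" for K
    using spread_nonneg[of K y] component_finite component_nonempty that
    by (auto simp: spread_def \<C>_def)
  have J_sub_c: "J K \<subseteq> c K" if "K \<in> \<C>" for K
    unfolding c_def using that le[OF that] U
    by (intro connected_component_maximal) (auto simp: J_def)
  \<comment> \<open>Each component interval is connected and so lies in a single block
    \<open>c K\<close>; this allows the graph components to be grouped by block.\<close>
  have blocks: "components U = c ` \<C>"
  proof (intro equalityI subsetI)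
    fix B assume "B \<in> components U"
    then obtain p where p: "p \<in> U" "B = connected_component_set U p" by (auto simp: components_def)
    then obtain K where K: "K \<in> \<C>" "p \<in> J K" using U by auto
    then have "p \<in> c K" using J_sub_c by auto
    then have "B = c K" using p by (simp add: c_def connected_component_eq)
    then show "B \<in> c ` \<C>" using K by auto
  next
    fix B assume "B \<in> c ` \<C>"
    then obtain K where K: "K \<in> \<C>" "B = c K" by auto
    then have "Min (y ` K) \<in> U" using le[OF K(1)] U by (auto simp: J_def)
    then show "B \<in> components U" using K by (auto simp: c_def components_def)
  qed
  have fin: "finite \<C>" by (simp add: \<C>_def finite_components)
  have "block_energy s n G y = (\<Sum>B\<in>c ` \<C>. (Sup B - Inf B) powr s)"
    unfolding block_energy_def U_def[symmetric] blocks ..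
  also have "\<dots> \<le> (\<Sum>B\<in>c ` \<C>. \<Sum>K\<in>{K \<in> \<C>. c K = B}. spread y K powr s)"
  proof (intro sum_mono)
    fix B assume B: "B \<in> c ` \<C>"
    define \<K> where "\<K> = {K \<in> \<C>. c K = B}"
    have BU: "B = (\<Union>K\<in>\<K>. J K)"
    proof (intro equalityI subsetI)
      fix p assume p: "p \<in> B"
      have "B \<subseteq> U" using B blocks in_components_subset by blast
      then obtain K where K: "K \<in> \<C>" "p \<in> J K" using p U by auto
      have "p \<in> c K" using K J_sub_c by auto
      moreover have "c K \<in> components U" "B \<in> components U" using K B blocks by auto
      ultimately have "c K = B" using p components_nonoverlap by blast
      then show "p \<in> (\<Union>K\<in>\<K>. J K)" using K by (auto simp: \<K>_def)
    qed (use J_sub_c in \<open>auto simp: \<K>_def\<close>)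
    have "finite \<K>" using fin by (simp add: \<K>_def)
    \<comment> \<open>As a finite union of compact intervals the block is compact; being connected
      too, it is a closed interval whose length is \<open>Sup B - Inf B\<close>.\<close>
    then have "compact B" unfolding BU by (auto simp: J_def)
    moreover have "connected B" "B \<noteq> {}"
      using B blocks in_components_connected in_components_nonempty by blast+
    ultimately obtain a b where ab: "B = {a..b}" by (metis connected_compact_interval_1 box_real(2))
    with \<open>B \<noteq> {}\<close> have "a \<le> b" by auto
    then have "Sup B - Inf B = b - a" using ab by simp
    also have "\<dots> \<le> (\<Sum>K\<in>\<K>. spread y K)"
      unfolding spread_def
    proof (rule interval_cover_length)
      show "{a..b} \<subseteq> (\<Union>K\<in>\<K>. {Min (y ` K)..Max (y ` K)})"
        unfolding ab[symmetric] J_def[symmetric] BU[symmetric] ..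
    qed (use \<open>finite \<K>\<close> le in \<open>auto simp: \<K>_def\<close>)
    finally have "(Sup B - Inf B) powr s \<le> (\<Sum>K\<in>\<K>. spread y K) powr s"
      using s \<open>a \<le> b\<close> ab by (intro powr_mono2) auto
    also have "\<dots> \<le> (\<Sum>K\<in>\<K>. spread y K powr s)"
      by (rule powr_sum_le) (use \<open>finite \<K>\<close> le s in \<open>auto simp: spread_def \<K>_def\<close>)
    finally show "(Sup B - Inf B) powr s \<le> (\<Sum>K\<in>{K \<in> \<C>. c K = B}. spread y K powr s)"
      by (simp add: \<K>_def)
  qed
  also have "\<dots> = (\<Sum>K\<in>\<C>. spread y K powr s)"
    by (rule sum.image_gen[OF fin, symmetric])
  finally show ?thesis by (simp add: \<C>_def)
qed

end

subsection \<open>Averaging dynamics\<close>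

text \<open>The gap in Cauchy-Schwarz is invariant under shifts, so values may be recentred at
  \<open>z i\<close>. Applied to a neighbourhood containing \<open>i\<close>, it quantifies what the
  self-loop gains.\<close>

lemma sum_sq_plus_deviation_le:
  fixes z :: "'a \<Rightarrow> real"
  assumes "finite N" "i \<in> N"
  shows "(\<Sum>j\<in>N. z j)\<^sup>2 + (\<Sum>j\<in>N. (z i - z j)\<^sup>2) \<le> real (card N) * (\<Sum>j\<in>N. (z j)\<^sup>2)"
proof -
  define w where "w j = z j - z i" for j
  define D W where "D = real (card N)" and "W = (\<Sum>j\<in>N. w j)"
  have D: "real (card (N - {i})) = D - 1"
    using assms using card_gt_0_iff[of N] by (auto simp: D_def card_Diff_singleton of_nat_diff Suc_le_eq)
  have w: "(\<Sum>j\<in>N. w j) = (\<Sum>j\<in>N - {i}. w j)" "(\<Sum>j\<in>N. (w j)\<^sup>2) = (\<Sum>j\<in>N - {i}. (w j)\<^sup>2)"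
    using assms by (auto simp: w_def sum.remove[of N i])
  \<comment> \<open>The term at \<open>i\<close> vanishes, so Cauchy-Schwarz runs over one index
    fewer. This saving is the whole gain.\<close>
  have W: "W\<^sup>2 \<le> (D - 1) * (\<Sum>j\<in>N. (w j)\<^sup>2)"
    using Cauchy_Schwarz_ineq_sum[of "\<lambda>_. 1" w "N - {i}"] w D by (simp add: W_def)
  have "(\<Sum>j\<in>N. z j) = W + D * z i"
    by (simp add: W_def w_def D_def sum_subtractf)
  moreover have "(\<Sum>j\<in>N. (z j)\<^sup>2) = (\<Sum>j\<in>N. (w j)\<^sup>2 + 2 * z i * w j + (z i)\<^sup>2)"
    by (intro sum.cong) (auto simp: w_def power2_eq_square algebra_simps)
  then have "(\<Sum>j\<in>N. (z j)\<^sup>2) = (\<Sum>j\<in>N. (w j)\<^sup>2) + 2 * z i * W + D * (z i)\<^sup>2"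
    by (simp add: sum.distrib W_def D_def sum_distrib_left)
  moreover have "(\<Sum>j\<in>N. (z i - z j)\<^sup>2) = (\<Sum>j\<in>N. (w j)\<^sup>2)"
    by (simp add: w_def power2_commute)
  ultimately show ?thesis
    using W unfolding D_def[symmetric] by (simp add: power2_eq_square algebra_simps)
qed

locale averaging =
  fixes n d :: nat and h :: real and A :: "nat \<Rightarrow> nat \<Rightarrow> nat \<Rightarrow> bool" and x :: "nat \<Rightarrow> nat \<Rightarrow> real"
  assumes graph: "\<And>t. expander_graph n d h (A t)"
    and update: "\<And>t i. i < n \<Longrightarrow> x (Suc t) i = (\<Sum>j\<in>{j. j < n \<and> A t i j}. x t j) / real d"
begin

section \<open>Isolated sets of agents and their components\<close>

sublocale expander_graph n d h "A t" for t by (rule graph)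

text \<open>An isolated set evolves as an averaging system of its own. Keeping the original indices
  lets the induction pass to parts without relabelling agents.\<close>

definition isolated :: "nat \<Rightarrow> nat set \<Rightarrow> bool" where
  "isolated t S \<longleftrightarrow> S \<subseteq> {..<n} \<and> (\<forall>i\<in>S. \<forall>j. A t i j \<longrightarrow> j \<in> S)"

definition comps :: "nat \<Rightarrow> nat set \<Rightarrow> nat set set" where
  "comps t S = {K \<in> graph_components n (A t). K \<subseteq> S}"

lemma d_pos: "0 < real d"
  using d_ge_2 by simp

lemma isolated_finite: "isolated t S \<Longrightarrow> finite S"
  by (auto simp: isolated_def intro: finite_subset)

lemma finite_comps: "finite (comps t S)"
  using finite_components by (simp add: comps_def)

lemma comps_props:
  assumes "K \<in> comps t S"
  shows comps_nonempty: "K \<noteq> {}" and comps_finite: "finite K" and comps_subset: "K \<subseteq> S"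
    and comps_component: "K \<in> graph_components n (A t)"
  using assms component_nonempty component_finite by (auto simp: comps_def)

lemma component_subset_isolated:
  assumes "isolated t S" "K \<in> graph_components n (A t)" "i \<in> K" "i \<in> S"
  shows "K \<subseteq> S"
  using component_subset_of_closed[OF assms(2-4)] assms(1) by (auto simp: isolated_def)

lemma Union_comps:
  assumes "isolated t S"
  shows "\<Union> (comps t S) = S"
proof (intro equalityI subsetI)
  fix i assume i: "i \<in> S"
  then have "i < n" using assms by (auto simp: isolated_def)
  then obtain K where K: "K \<in> graph_components n (A t)" "i \<in> K"
    using component_exists[of i t] by blast
  moreover have "K \<subseteq> S"
    by (rule component_subset_isolated[OF assms K i])
  ultimately show "i \<in> \<Union> (comps t S)" by (auto simp: comps_def)
qed (auto simp: comps_def)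

lemma sum_comps:
  fixes F :: "nat \<Rightarrow> real"
  assumes "isolated t S"
  shows "(\<Sum>i\<in>S. F i) = (\<Sum>K\<in>comps t S. \<Sum>i\<in>K. F i)"
proof -
  have "sum F (\<Union> (comps t S)) = (sum \<circ> sum) F (comps t S)"
    by (rule sum.Union_disjoint) (use comps_finite comps_component component_unique in blast)+
  then show ?thesis using Union_comps[OF assms] by simp
qed

lemma neighbours_isolated:
  assumes "isolated t S" "i \<in> S"
  shows "{j. j < n \<and> A t i j} = {j \<in> S. A t i j}"
  using assms edge_less by (auto simp: isolated_def)

text \<open>Double counting: by symmetry the column sums of the adjacency matrix equal
  \<open>d\<close> as well. This conserves the mean and lets local inequalities be summed.\<close>

lemma sum_neighbours:
  fixes F :: "nat \<Rightarrow> real"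
  assumes "isolated t S"
  shows "(\<Sum>i\<in>S. \<Sum>j\<in>{j \<in> S. A t i j}. F j) = real d * (\<Sum>j\<in>S. F j)"
proof -
  have "(\<Sum>i\<in>S. \<Sum>j\<in>{j \<in> S. A t i j}. F j) = (\<Sum>j\<in>S. \<Sum>i\<in>{i \<in> S. A t i j}. F j)"
    using isolated_finite[OF assms] by (intro sum.swap_restrict)
  also have "\<dots> = (\<Sum>j\<in>S. real d * F j)"
  proof (intro sum.cong refl)
    fix j assume j: "j \<in> S"
    have "{i \<in> S. A t i j} = {i. i < n \<and> A t j i}"
      using j assms edge_sym edge_less by (auto simp: isolated_def)
    then show "(\<Sum>i\<in>{i \<in> S. A t i j}. F j) = real d * F j"
      using degree_eq[of j t] j assms by (auto simp: isolated_def)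
  qed
  finally show ?thesis by (simp add: sum_distrib_left)
qed

section \<open>Conserved mean and decreasing potential\<close>

lemma mean_step:
  assumes "isolated t S"
  shows "mean (x (Suc t)) S = mean (x t) S"
proof -
  have "(\<Sum>i\<in>S. x (Suc t) i) = (\<Sum>i\<in>S. (\<Sum>j\<in>{j \<in> S. A t i j}. x t j) / real d)"
    using assms by (intro sum.cong refl) (use neighbours_isolated[OF assms] in \<open>auto simp: update isolated_def subset_eq\<close>)
  also have "\<dots> = (\<Sum>i\<in>S. x t i)"
    using sum_neighbours[OF assms, of "x t"] d_pos by (simp flip: sum_divide_distrib)
  finally show ?thesis by (simp add: mean_def)
qed

text \<open>For each agent, the square of the averaged value loses a multiple of the squared
  differences along its edges. Summing over \<open>S\<close> leaves an edge sum, which Cheeger's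
  inequality bounds below on every component.\<close>

lemma sqdev_decrease:
  assumes S: "isolated t S"
  shows "real d * sqdev (x (Suc t)) S + (h\<^sup>2 / (real d)\<^sup>2) * (\<Sum>K\<in>comps t S. sqdev (x t) K)
    \<le> real d * sqdev (x t) S"
proof -
  define \<mu> where "\<mu> = mean (x t) S"
  define N where "N i = {j \<in> S. A t i j}" for i
  define z where "z i = x t i - \<mu>" for i
  have N: "finite (N i)" "i \<in> N i" "card (N i) = d" if "i \<in> S" for i
    using that S loop[of i t] degree_eq[of i t] neighbours_isolated[OF S that] isolated_finite[OF S]
    by (auto simp: N_def isolated_def)
  have local: "real d * (x (Suc t) i - \<mu>)\<^sup>2 + (\<Sum>j\<in>N i. (z i - z j)\<^sup>2) / real d \<le> (\<Sum>j\<in>N i. (z j)\<^sup>2)"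
    if "i \<in> S" for i
  proof -
    have "i < n" using that S by (auto simp: isolated_def)
    then have "x (Suc t) i - \<mu> = (\<Sum>j\<in>N i. x t j) / real d - \<mu>"
      using update neighbours_isolated[OF S that] by (simp add: N_def)
    also have "\<dots> = (\<Sum>j\<in>N i. z j) / real d"
      using N[OF that] d_pos by (simp add: z_def sum_subtractf field_simps)
    finally have "real d * (x (Suc t) i - \<mu>)\<^sup>2 = (\<Sum>j\<in>N i. z j)\<^sup>2 / real d"
      using d_pos by (simp add: power2_eq_square)
    then have "real d * (x (Suc t) i - \<mu>)\<^sup>2 + (\<Sum>j\<in>N i. (z i - z j)\<^sup>2) / real d
      = ((\<Sum>j\<in>N i. z j)\<^sup>2 + (\<Sum>j\<in>N i. (z i - z j)\<^sup>2)) / real d"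
      by (simp add: add_divide_distrib)
    also have "\<dots> \<le> (\<Sum>j\<in>N i. (z j)\<^sup>2)"
      using sum_sq_plus_deviation_le[OF N(1,2)[OF that], of z] N(3)[OF that] d_pos
      by (simp add: divide_le_eq mult.commute)
    finally show ?thesis .
  qed
  have edges: "h\<^sup>2 / real d * (\<Sum>K\<in>comps t S. sqdev (x t) K) \<le> (\<Sum>i\<in>S. \<Sum>j\<in>N i. (z i - z j)\<^sup>2)"
  proof -
    have "h\<^sup>2 / real d * sqdev (x t) K \<le> (\<Sum>i\<in>K. \<Sum>j\<in>N i. (z i - z j)\<^sup>2)" if K: "K \<in> comps t S" for K
    proof -
      interpret K: expander K "{(i, j). i \<in> K \<and> A t i j}" h d
        by (rule component_expander[OF comps_component[OF K]])
      have "{(i, j). i \<in> K \<and> A t i j} = Sigma K N"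
        using comps_subset[OF K] S by (auto simp: N_def isolated_def)
      then have "(\<Sum>(i, j)\<in>{(i, j). i \<in> K \<and> A t i j}. (x t i - x t j)\<^sup>2)
          = (\<Sum>i\<in>K. \<Sum>j\<in>N i. (x t i - x t j)\<^sup>2)"
        using comps_finite[OF K] N(1) comps_subset[OF K] by (subst sum.Sigma) auto
      then show ?thesis
        using K.cheeger_inequality[of "x t"] d_pos by (simp add: z_def divide_le_eq mult.commute)
    qed
    then show ?thesis
      unfolding sum_comps[OF S] sum_distrib_left by (rule sum_mono)
  qed
  have "real d * sqdev (x (Suc t)) S + (h\<^sup>2 / (real d)\<^sup>2) * (\<Sum>K\<in>comps t S. sqdev (x t) K)
      \<le> real d * sqdev (x (Suc t)) S + (\<Sum>i\<in>S. \<Sum>j\<in>N i. (z i - z j)\<^sup>2) / real d"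
    using divide_right_mono[OF edges, of "real d"] d_pos by (simp add: power2_eq_square)
  also have "\<dots> = (\<Sum>i\<in>S. real d * (x (Suc t) i - \<mu>)\<^sup>2 + (\<Sum>j\<in>N i. (z i - z j)\<^sup>2) / real d)"
    by (simp add: sqdev_def \<mu>_def mean_step[OF S] sum.distrib sum_distrib_left sum_divide_distrib)
  also have "\<dots> \<le> (\<Sum>i\<in>S. \<Sum>j\<in>N i. (z j)\<^sup>2)"
    using local by (rule sum_mono)
  also have "\<dots> = real d * sqdev (x t) S"
    using sum_neighbours[OF S, of "\<lambda>j. (z j)\<^sup>2"] by (simp add: N_def z_def \<mu>_def sqdev_def)
  finally show ?thesis .
qed

lemma sqdev_antimono:
  assumes "\<And>t. t0 \<le> t \<Longrightarrow> t < t1 \<Longrightarrow> isolated t S" "t0 \<le> t1"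
  shows "sqdev (x t1) S \<le> sqdev (x t0) S"
  using assms(2,1)
proof (induction t1 rule: dec_induct)
  case (step t)
  have "0 \<le> (h\<^sup>2 / (real d)\<^sup>2) * (\<Sum>K\<in>comps t S. sqdev (x t) K)"
    by (intro mult_nonneg_nonneg sum_nonneg sqdev_nonneg) auto
  then have "real d * sqdev (x (Suc t)) S \<le> real d * sqdev (x t) S"
    using sqdev_decrease[of t S] step.prems[of t] step.hyps by simp
  then have "sqdev (x (Suc t)) S \<le> sqdev (x t) S" using d_pos by simp
  also have "\<dots> \<le> sqdev (x t0) S" using step.prems by (intro step.IH) auto
  finally show ?case .
qed simp

lemma bounds_preserved:
  assumes iso: "\<And>t. t0 \<le> t \<Longrightarrow> t < t1 \<Longrightarrow> isolated t S" and "t0 \<le> t1"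
    and bounds: "\<And>i. i \<in> S \<Longrightarrow> x t0 i \<in> {a..b}" and "i \<in> S"
  shows "x t1 i \<in> {a..b}"
  using assms(2) iso \<open>i \<in> S\<close>
proof (induction t1 arbitrary: i rule: dec_induct)
  case (step t)
  have S: "isolated t S" using step.prems(1)[of t] step.hyps by simp
  have *: "x t j \<in> {a..b}" if "j \<in> S" for j using step.IH[of j] step.prems(1) that by simp
  define N where "N = {j \<in> S. A t i j}"
  have i: "i < n" using S step.prems(2) by (auto simp: isolated_def)
  then have card: "card N = d"
    using degree_eq[of i t] neighbours_isolated[OF S step.prems(2)] by (simp add: N_def)
  have "(\<Sum>j\<in>N. x t j) \<le> real d * b" "real d * a \<le> (\<Sum>j\<in>N. x t j)"
    using * card sum_bounded_above[of N "x t" b] sum_bounded_below[of N a "x t"]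
    by (auto simp: N_def)
  moreover have "x (Suc t) i = (\<Sum>j\<in>N. x t j) / real d"
    using i update neighbours_isolated[OF S step.prems(2)] by (simp add: N_def)
  ultimately show ?case using d_pos by (simp add: divide_le_eq le_divide_eq mult.commute)
qed (use bounds in simp)

lemma spread_powr_le:
  assumes K: "K \<in> comps t S" and "finite S" "0 < s"
  shows "spread (x t) K powr s \<le> (real d * sqdev (x t) S) powr (s / 2)"
proof -
  note K' = comps_nonempty[OF K] comps_finite[OF K] comps_subset[OF K]
  have "spread (x t) K powr s = ((spread (x t) K)\<^sup>2) powr (s / 2)"
    using spread_nonneg[OF K'(2,1), of "x t"]
    by (cases "spread (x t) K = 0") (auto simp: powr_powr simp flip: powr_numeral)
  also have "\<dots> \<le> (real d * sqdev (x t) S) powr (s / 2)"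
  proof (intro powr_mono2)
    have "(spread (x t) K)\<^sup>2 \<le> 2 * sqdev (x t) K" by (rule spread_sq_le_sqdev[OF K'(2,1)])
    also have "\<dots> \<le> 2 * sqdev (x t) S" using sqdev_mono[OF assms(2) K'(3)] by simp
    \<comment> \<open>The factor 2 is absorbed by the degree, which is at least 2.\<close>
    also have "\<dots> \<le> real d * sqdev (x t) S" using d_ge_2 sqdev_nonneg by (intro mult_right_mono) auto
    finally show "(spread (x t) K)\<^sup>2 \<le> real d * sqdev (x t) S" .
  qed (use assms in auto)
  finally show ?thesis .
qed

text \<open>Taken over graph components rather than blocks, because the blocks of two isolated parts
  may overlap on the line.\<close>

definition energy :: "real \<Rightarrow> nat \<Rightarrow> nat set \<Rightarrow> real" where
  "energy s t S = (\<Sum>K\<in>comps t S. spread (x t) K powr s)"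

lemma energy_le_card:
  assumes "finite S" "0 < s" "card (comps t S) \<le> m"
  shows "energy s t S \<le> real m * (real d * sqdev (x t) S) powr (s / 2)"
proof -
  have "energy s t S \<le> real (card (comps t S)) * (real d * sqdev (x t) S) powr (s / 2)"
    unfolding energy_def using assms(1,2) by (intro sum_bounded_above spread_powr_le)
  also have "\<dots> \<le> real m * (real d * sqdev (x t) S) powr (s / 2)"
    using assms(3) by (intro mult_right_mono) auto
  finally show ?thesis .
qed

text \<open>The geometric series in inductive form, over the remaining horizon
  \<open>T - t0\<close>. A nonempty \<open>S\<close> is then a single component, so every step
  contracts its potential by \<open>1 - \<delta>\<close>.\<close>

lemma connected_energy_bound:
  assumes s: "0 < s" "s \<le> 1"
    and "\<And>t. t0 \<le> t \<Longrightarrow> t < T \<Longrightarrow> isolated t S \<and> card (comps t S) \<le> 1"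
  shows "(\<Sum>t\<in>{t0..<T}. energy s t S)
    \<le> (real d * sqdev (x t0) S) powr (s / 2) * (2 * real d ^ 3 / (h\<^sup>2 * s))"
  using assms(3)
proof (induction "T - t0" arbitrary: t0)
  case 0
  then show ?case using s by (simp add: zero_le_mult_iff)
next
  case (Suc k)
  define B where "B = 2 * real d ^ 3 / (h\<^sup>2 * s)"
  define \<delta> where "\<delta> = h\<^sup>2 / real d ^ 3"
  define V where "V t = real d * sqdev (x t) S" for t
  have V0: "0 \<le> V t" for t by (simp add: V_def sqdev_nonneg)
  have t0: "t0 < T" using Suc.hyps(2) by simp
  have S: "isolated t0 S" "card (comps t0 S) \<le> 1" using Suc.prems t0 by auto
  \<comment> \<open>This makes \<open>B\<close> the fixed point of
    \<open>B = 1 + (1 - \<delta> * s / 2) * B\<close>, which closes the induction.\<close>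
  have B: "B \<ge> 0" "\<delta> * s / 2 * B = 1"
    using s h_pos d_pos by (auto simp: B_def \<delta>_def field_simps)
  have "(\<Sum>t\<in>{t0..<T}. energy s t S) = energy s t0 S + (\<Sum>t\<in>{Suc t0..<T}. energy s t S)"
    using t0 by (rule sum.atLeast_Suc_lessThan)
  also have "\<dots> \<le> V t0 powr (s / 2) + V (Suc t0) powr (s / 2) * B"
    unfolding V_def B_def
    using energy_le_card[OF isolated_finite[OF S(1)] s(1) S(2)] Suc.hyps(2) Suc.prems
    by (intro add_mono Suc.hyps(1)) auto
  also have "\<dots> \<le> V t0 powr (s / 2) + ((1 - \<delta> * s / 2) * V t0 powr (s / 2)) * B"
  proof (cases "S = {}")
    case True
    then show ?thesis by (simp add: V_def sqdev_def)
  next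
    case False
    then obtain K where K: "K \<in> comps t0 S" using Union_comps[OF S(1)] by blast
    then have "comps t0 S = {K}"
      using S(2) finite_comps card_le_Suc0_iff_eq[of "comps t0 S"] by auto
    then have comps: "comps t0 S = {S}" using Union_comps[OF S(1)] by simp
    have "\<delta> * V t0 = h\<^sup>2 / (real d)\<^sup>2 * sqdev (x t0) S"
      using d_pos by (simp add: \<delta>_def V_def power2_eq_square power3_eq_cube)
    then have "V (Suc t0) \<le> (1 - \<delta>) * V t0"
      using sqdev_decrease[OF S(1)] by (simp add: V_def comps algebra_simps)
    moreover have "0 \<le> \<delta>" "\<delta> \<le> 1"
      using h_sq_le_d_cube[OF comps_component[OF K]] d_pos by (auto simp: \<delta>_def)
    ultimately have "V (Suc t0) powr (s / 2) \<le> (1 - \<delta> * s / 2) * V t0 powr (s / 2)"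
      using powr_contraction_le[of "s / 2" \<delta> "V (Suc t0)" "V t0"] s V0
      by (simp add: mult.commute)
    then show ?thesis using B(1) by (intro add_left_mono mult_right_mono)
  qed
  also have "\<dots> = V t0 powr (s / 2) * (1 + B - \<delta> * s / 2 * B)" by (simp add: algebra_simps)
  finally show ?case using B(2) by (simp add: V_def B_def)
qed

end

subsection \<open>Contraction once all cuts are crossed\<close>

lemma sum_squares_le_square_sum:
  fixes f :: "'a \<Rightarrow> real"
  assumes "finite I" "\<And>i. i \<in> I \<Longrightarrow> 0 \<le> f i"
  shows "(\<Sum>i\<in>I. (f i)\<^sup>2) \<le> (\<Sum>i\<in>I. f i)\<^sup>2"
proof -
  have "(\<Sum>i\<in>I. (f i)\<^sup>2) \<le> (\<Sum>i\<in>I. f i * sum f I)"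
    unfolding power2_eq_square using assms by (intro sum_mono mult_left_mono member_le_sum) auto
  then show ?thesis by (simp add: power2_eq_square sum_distrib_right)
qed

lemma square_sum_le_card:
  fixes f :: "'a \<Rightarrow> real"
  assumes "card I \<le> m"
  shows "(\<Sum>i\<in>I. f i)\<^sup>2 \<le> real m * (\<Sum>i\<in>I. (f i)\<^sup>2)"
proof -
  have "(\<Sum>i\<in>I. f i)\<^sup>2 \<le> real (card I) * (\<Sum>i\<in>I. (f i)\<^sup>2)"
    using Cauchy_Schwarz_ineq_sum[of "\<lambda>_. 1" f I] by simp
  also have "\<dots> \<le> real m * (\<Sum>i\<in>I. (f i)\<^sup>2)"
    using assms by (intro mult_right_mono sum_nonneg) auto
  finally show ?thesis .
qed

text \<open>\<open>{q r..r}\<close> is the gap to the left of the left endpoint \<open>r\<close>, degenerate if there is none.\<close>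

lemma interval_gaps:
  fixes a b :: "'a \<Rightarrow> real"
  assumes fin: "finite \<C>" and le: "\<And>K. K \<in> \<C> \<Longrightarrow> a K \<le> b K"
  shows "\<exists>q. (\<forall>r. q r \<le> r) \<and> (\<forall>r. q r < r \<longrightarrow> (\<exists>K\<in>\<C>. a K < r)) \<and>
    (\<forall>r. \<forall>K\<in>\<C>. q r < r \<longrightarrow> a K < r \<longrightarrow> b K \<le> q r) \<and>
    (\<forall>K\<in>\<C>. \<forall>K'\<in>\<C>. b K' - a K \<le> (\<Sum>K\<in>\<C>. b K - a K) + (\<Sum>r\<in>a ` \<C>. r - q r))"
proof -
  \<comment> \<open>\<open>M r\<close> is how far the intervals starting left of \<open>r\<close>
    reach. Capping it at \<open>r\<close> makes the gap degenerate when they reach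
    \<open>r\<close>.\<close>
  define M where "M r = Max (b ` {K \<in> \<C>. a K < r})" for r
  define q where "q r = (if \<exists>K\<in>\<C>. a K < r then min r (M r) else r)" for r
  have M: "b K \<le> M r" if "K \<in> \<C>" "a K < r" for K r
    unfolding M_def using that fin by (intro Max_ge) auto
  have q_le: "q r \<le> r" for r by (simp add: q_def)
  moreover have "\<exists>K\<in>\<C>. a K < r" if "q r < r" for r using that by (auto simp: q_def split: if_splits)
  moreover have "b K \<le> q r" if "q r < r" "K \<in> \<C>" "a K < r" for r K
    using that M[of K r] by (auto simp: q_def min_def split: if_splits)
  moreover have "b K2 - a K1 \<le> (\<Sum>K\<in>\<C>. b K - a K) + (\<Sum>r\<in>a ` \<C>. r - q r)"
    if K: "K1 \<in> \<C>" "K2 \<in> \<C>" for K1 K2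
  proof -
    \<comment> \<open>Intervals and gaps together form one cover, indexed by a disjoint sum.\<close>
    have "b K2 - a K1 \<le> (\<Sum>k\<in>\<C> <+> a ` \<C>. case_sum b id k - case_sum a q k)"
    proof (rule interval_cover_length)
      show "{a K1..b K2} \<subseteq> (\<Union>k\<in>\<C> <+> a ` \<C>. {case_sum a q k..case_sum b id k})"
      proof
        fix p assume p: "p \<in> {a K1..b K2}"
        show "p \<in> (\<Union>k\<in>\<C> <+> a ` \<C>. {case_sum a q k..case_sum b id k})"
        proof (cases "\<exists>K\<in>\<C>. a K \<le> p \<and> p \<le> b K")
          case True
          then obtain K where "K \<in> \<C>" "a K \<le> p" "p \<le> b K" by blast
          then show ?thesis by (intro UN_I[of "Inl K"]) auto
        next
          case False
          define F where "F = {v \<in> a ` \<C>. p < v}"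
          have F: "finite F" "a K2 \<in> F" using fin K p False by (auto simp: F_def not_le)
          \<comment> \<open>An uncovered point \<open>p\<close> lies in the gap before the next left
            endpoint \<open>r\<close>: every interval starting before \<open>r\<close> has already
            ended before \<open>p\<close>.\<close>
          define r where "r = Min F"
          have r: "r \<in> F" unfolding r_def using F by (intro Min_in) auto
          have below: "b K < p" if "K \<in> \<C>" "a K < r" for K
          proof -
            have "a K \<notin> F" using Min_le[OF F(1), of "a K"] that by (auto simp: r_def)
            then show ?thesis using that False by (auto simp: F_def not_le)
          qed
          have K1: "K1 \<in> {K \<in> \<C>. a K < r}" using K r p by (auto simp: F_def)
          then have "M r \<in> b ` {K \<in> \<C>. a K < r}" unfolding M_def using fin by (intro Max_in) auto
          then have "M r < p" using below by auto
          moreover have "q r = min r (M r)" using K1 by (auto simp: q_def)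
          ultimately have "q r \<le> p" by simp
          moreover have "p < r" "r \<in> a ` \<C>" using r by (auto simp: F_def)
          ultimately show ?thesis by (intro UN_I[of "Inr r"]) auto
        qed
      qed
    qed (use fin le q_le in auto)
    also have "\<dots> = (\<Sum>K\<in>\<C>. b K - a K) + (\<Sum>r\<in>a ` \<C>. r - q r)"
      using fin by (simp add: sum.Plus)
    finally show ?thesis .
  qed
  ultimately show ?thesis by blast
qed

context averaging
begin

lemma comps_member:
  assumes "isolated t S" "i \<in> S"
  obtains K where "K \<in> comps t S" "i \<in> K"
  using assms Union_comps by blast

text \<open>Until its first crossing, the two sides of a gap evolve independently, so both stay on their
  side; the component that carries the first crossing edge therefore spans the whole gap.\<close>

lemma component_straddles_gap:
  assumes iso: "\<And>t. t0 \<le> t \<Longrightarrow> t \<le> t1 \<Longrightarrow> isolated t S"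
    and gap: "q < r" "\<And>i. i \<in> S \<Longrightarrow> x t0 i \<le> q \<or> r \<le> x t0 i"
    and crossed: "\<exists>t\<in>{t0..t1}. \<exists>i\<in>S. \<exists>j\<in>S. x t0 i \<le> q \<and> q < x t0 j \<and> A t i j"
  shows "\<exists>t\<in>{t0..t1}. \<exists>K\<in>comps t S. Min (x t ` K) \<le> q \<and> r \<le> Max (x t ` K)"
proof -
  define L where "L = {i \<in> S. x t0 i \<le> q}"
  define P where "P t \<longleftrightarrow> t0 \<le> t \<and> (\<exists>i\<in>L. \<exists>j\<in>S - L. A t i j)" for t
  define t where "t = (LEAST t. P t)"
  obtain t' where t': "P t'" "t' \<le> t1" using crossed by (force simp: P_def L_def)
  then have t: "P t" "t \<le> t1" unfolding t_def using LeastI[of P] Least_le[of P t'] by auto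
  have not_before: "\<not> P u" if "u < t" for u using that not_less_Least by (auto simp: t_def)
  obtain i j where ij: "i \<in> L" "j \<in> S - L" "A t i j" using t by (auto simp: P_def)
  have S: "finite S" using iso[of t] t isolated_finite by (auto simp: P_def)
  have bounds: "x t0 k \<in> {Min (x t0 ` S)..Max (x t0 ` S)}" if "k \<in> S" for k
    using that S by auto
  have sides: "isolated u L" "isolated u (S - L)" if "t0 \<le> u" "u < t" for u
  proof -
    have S: "isolated u S" using that t iso by auto
    have no: "\<not> A u k l" if "k \<in> L" "l \<in> S - L" for k l
      using that not_before[OF \<open>u < t\<close>] \<open>t0 \<le> u\<close> by (auto simp: P_def)
    show "isolated u L" using S no unfolding isolated_def L_def by blast
    show "isolated u (S - L)" using S no edge_sym[of u] unfolding isolated_def L_def by blast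
  qed
  have "t0 \<le> t" using t by (simp add: P_def)
  \<comment> \<open>Values at time \<open>t\<close> result from the graphs before \<open>t\<close>,
    so the crossing edge at \<open>t\<close> has not acted yet and both endpoints are still on their
    own sides.\<close>
  have "x t i \<in> {Min (x t0 ` S)..q}"
    by (rule bounds_preserved[OF sides(1) \<open>t0 \<le> t\<close> _ ij(1)]) (use bounds in \<open>auto simp: L_def\<close>)
  moreover have right: "x t0 k \<in> {r..Max (x t0 ` S)}" if "k \<in> S - L" for k
    using that bounds[of k] gap(2)[of k] by (auto simp: L_def)
  have "x t j \<in> {r..Max (x t0 ` S)}"
    by (rule bounds_preserved[OF sides(2) \<open>t0 \<le> t\<close> right ij(2)])
  moreover obtain K where K: "K \<in> comps t S" "i \<in> K"
    using comps_member[of t S i] iso t ij by (auto simp: P_def L_def)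
  moreover have "j \<in> K" using component_closed[OF comps_component[OF K(1)] K(2) ij(3)] .
  moreover have "Min (x t ` K) \<le> x t i" "x t j \<le> Max (x t ` K)"
    using K \<open>j \<in> K\<close> comps_finite[OF K(1)] by auto
  ultimately have "Min (x t ` K) \<le> q" "r \<le> Max (x t ` K)" by auto
  then show ?thesis using K t \<open>t0 \<le> t\<close> by auto
qed

lemma sqdev_decrease_interval:
  assumes "\<And>t. t0 \<le> t \<Longrightarrow> t < t1 \<Longrightarrow> isolated t S" "t0 \<le> t1"
  shows "real d * sqdev (x t1) S + (h\<^sup>2 / (real d)\<^sup>2) * (\<Sum>t\<in>{t0..<t1}. \<Sum>K\<in>comps t S. sqdev (x t) K)
    \<le> real d * sqdev (x t0) S"
  using assms(2,1)
proof (induction t1 rule: dec_induct)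
  case (step t)
  have "real d * sqdev (x (Suc t)) S + (h\<^sup>2 / (real d)\<^sup>2) * (\<Sum>K\<in>comps t S. sqdev (x t) K)
    \<le> real d * sqdev (x t) S"
    using step.prems[of t] step.hyps by (intro sqdev_decrease) auto
  moreover have "real d * sqdev (x t) S
      + (h\<^sup>2 / (real d)\<^sup>2) * (\<Sum>t\<in>{t0..<t}. \<Sum>K\<in>comps t S. sqdev (x t) K) \<le> real d * sqdev (x t0) S"
    using step.prems by (intro step.IH) auto
  ultimately show ?case using step.hyps by (simp add: distrib_left)
qed simp

text \<open>The initial range of \<open>S\<close> is covered by the at most \<open>m\<close> component intervals at time \<open>t0\<close>
  and the at most \<open>m\<close> gaps between them. A later component may be the first to cross several
  gaps, but these are disjoint subintervals of its range, so its squared spread pays for the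
  squares of all of them.\<close>

lemma spread_sq_le_component_spreads:
  assumes iso: "\<And>t. t0 \<le> t \<Longrightarrow> t \<le> t1 \<Longrightarrow> isolated t S" and "t0 \<le> t1"
    and "S \<noteq> {}" and m: "card (comps t0 S) \<le> m"
    and crossed: "\<And>p. \<exists>i\<in>S. x t0 i \<le> p \<Longrightarrow> \<exists>j\<in>S. p < x t0 j \<Longrightarrow>
      \<exists>t\<in>{t0..t1}. \<exists>i\<in>S. \<exists>j\<in>S. x t0 i \<le> p \<and> p < x t0 j \<and> A t i j"
  shows "(spread (x t0) S)\<^sup>2 \<le> 2 * real m * (\<Sum>t\<in>{t0..t1}. \<Sum>K\<in>comps t S. (spread (x t) K)\<^sup>2)"
proof -
  define \<C> where "\<C> = comps t0 S"
  define a b where "a K = Min (x t0 ` K)" and "b K = Max (x t0 ` K)" for K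
  define R where "R = a ` \<C>"
  have S: "isolated t0 S" "finite S" using iso[of t0] \<open>t0 \<le> t1\<close> isolated_finite by auto
  have fin: "finite \<C>" "finite R" "card \<C> \<le> m" "card R \<le> m"
    using finite_comps m card_image_le[of \<C> a] by (auto simp: \<C>_def R_def)
  have in_comp: "a K \<le> x t0 i" "x t0 i \<le> b K" if "K \<in> \<C>" "i \<in> K" for i K
    using that comps_finite[of K t0 S] by (auto simp: a_def b_def \<C>_def)
  have attain: "\<exists>i\<in>K. a K = x t0 i" if "K \<in> \<C>" for K
    using that spread_attained[of K "x t0"] comps_finite comps_nonempty
    unfolding a_def \<C>_def by metis
  have ab: "a K \<le> b K" if "K \<in> \<C>" for K
    using attain[OF that] in_comp[OF that] by auto
  have comp_S: "K \<subseteq> S" if "K \<in> \<C>" for K using that comps_subset by (auto simp: \<C>_def)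
  obtain q where q: "\<And>r. q r \<le> r" "\<And>r. q r < r \<Longrightarrow> \<exists>K\<in>\<C>. a K < r"
    "\<And>r K. q r < r \<Longrightarrow> K \<in> \<C> \<Longrightarrow> a K < r \<Longrightarrow> b K \<le> q r"
    "\<And>K K'. K \<in> \<C> \<Longrightarrow> K' \<in> \<C> \<Longrightarrow> b K' - a K \<le> (\<Sum>K\<in>\<C>. b K - a K) + (\<Sum>r\<in>R. r - q r)"
    using interval_gaps[of \<C> a b, OF fin(1) ab, folded R_def] by blast
  define R' where "R' = {r \<in> R. q r < r}"
  have "finite R'" using fin by (simp add: R'_def)
  \<comment> \<open>Time \<open>t0\<close> is left out because the components of that time already
    pay for their own intervals in the cover.\<close>
  define Z where "Z = Sigma {t0<..t1} (\<lambda>t. comps t S)"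
  have "finite Z" by (simp add: Z_def finite_comps)
  have "\<exists>z\<in>Z. Min (x (fst z) ` snd z) \<le> q r \<and> r \<le> Max (x (fst z) ` snd z)" if "r \<in> R'" for r
  proof -
    have r: "r \<in> R" "q r < r" using that by (auto simp: R'_def)
    have gap: "x t0 i \<le> q r \<or> r \<le> x t0 i" if i: "i \<in> S" for i
    proof -
      obtain K where K: "K \<in> \<C>" "i \<in> K" using comps_member[OF S(1) i] by (auto simp: \<C>_def)
      then show ?thesis
        using q(3)[OF r(2) K(1)] in_comp[OF K] by (cases "a K < r") auto
    qed
    obtain K where K: "K \<in> \<C>" "a K < r" using q(2)[OF r(2)] by blast
    have "\<exists>i\<in>S. x t0 i \<le> q r"
      using q(3)[OF r(2) K] ab[OF K(1)] attain[OF K(1)] comp_S[OF K(1)] by force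
    moreover have "\<exists>j\<in>S. q r < x t0 j"
    proof -
      obtain K where "K \<in> \<C>" "a K = r" using r(1) by (auto simp: R_def)
      then show ?thesis using attain[of K] comp_S[of K] r(2) by auto
    qed
    ultimately obtain t K where t: "t \<in> {t0..t1}" "K \<in> comps t S"
      "Min (x t ` K) \<le> q r" "r \<le> Max (x t ` K)"
      using component_straddles_gap[of t0 t1 S "q r" r, OF iso r(2) gap crossed] by blast
    \<comment> \<open>By construction of the gaps, an interval of time \<open>t0\<close> starting
      left of \<open>r\<close> ends by \<open>q r\<close>, so it cannot span the gap.\<close>
    have "t \<noteq> t0"
    proof
      assume "t = t0"
      then have "K \<in> \<C>" "a K \<le> q r" "r \<le> b K" using t by (auto simp: \<C>_def a_def b_def)
      then show False using q(3)[OF r(2), of K] r(2) by auto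
    qed
    then have "(t, K) \<in> Z" using t by (auto simp: Z_def)
    then show ?thesis using t by (intro bexI[of _ "(t, K)"]) auto
  qed
  then obtain \<phi> where \<phi>: "\<And>r. r \<in> R' \<Longrightarrow> \<phi> r \<in> Z"
    "\<And>r. r \<in> R' \<Longrightarrow> Min (x (fst (\<phi> r)) ` snd (\<phi> r)) \<le> q r"
    "\<And>r. r \<in> R' \<Longrightarrow> r \<le> Max (x (fst (\<phi> r)) ` snd (\<phi> r))"
    by metis
  have disjoint: "disjoint_family_on (\<lambda>r. {q r<..<r}) R'"
  proof -
    have "r \<le> q r'" if r: "r \<in> R'" "r' \<in> R'" "r < r'" for r r'
    proof -
      obtain K where "K \<in> \<C>" "a K = r" using r by (auto simp: R'_def R_def)
      then show ?thesis using q(3)[of r' K] ab[of K] r by (auto simp: R'_def)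
    qed
    then have "{q r<..<r} \<inter> {q r'<..<r'} = {}" if "r \<in> R'" "r' \<in> R'" "r < r'" for r r'
      using that by force
    then show ?thesis
      unfolding disjoint_family_on_def by (metis inf_commute linorder_neqE_linordered_idom)
  qed
  have late: "(\<Sum>r\<in>R. (r - q r)\<^sup>2) \<le> (\<Sum>(t, K)\<in>Z. (spread (x t) K)\<^sup>2)"
  proof -
    have "(\<Sum>r\<in>R. (r - q r)\<^sup>2) = (\<Sum>r\<in>R'. (r - q r)\<^sup>2)"
    proof (intro sum.mono_neutral_right ballI)
      fix r assume "r \<in> R - R'"
      then have "q r = r" using q(1)[of r] by (auto simp: R'_def)
      then show "(r - q r)\<^sup>2 = 0" by simp
    qed (use fin in \<open>auto simp: R'_def\<close>)
    \<comment> \<open>Gaps are grouped by the component charged for them, so that each group is a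
      packing inside the range of one component.\<close>
    also have "\<dots> = (\<Sum>z\<in>Z. \<Sum>r\<in>{r \<in> R'. \<phi> r = z}. (r - q r)\<^sup>2)"
      using \<open>finite R'\<close> \<open>finite Z\<close> \<phi>(1) by (intro sum.group[symmetric]) auto
    also have "\<dots> \<le> (\<Sum>z\<in>Z. (spread (x (fst z)) (snd z))\<^sup>2)"
    proof (intro sum_mono)
      fix z assume z: "z \<in> Z"
      define Q where "Q = {r \<in> R'. \<phi> r = z}"
      have z': "snd z \<in> comps (fst z) S" using z by (auto simp: Z_def)
      have "finite Q" using \<open>finite R'\<close> by (simp add: Q_def)
      have "(\<Sum>r\<in>Q. (r - q r)\<^sup>2) \<le> (\<Sum>r\<in>Q. r - q r)\<^sup>2"
        using \<open>finite Q\<close> q(1) by (intro sum_squares_le_square_sum) auto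
      also have "\<dots> \<le> (spread (x (fst z)) (snd z))\<^sup>2"
      proof (intro power_mono sum_nonneg)
        show "(\<Sum>r\<in>Q. r - q r) \<le> spread (x (fst z)) (snd z)"
          unfolding spread_def
        proof (rule interval_packing_length)
          show "Min (x (fst z) ` snd z) \<le> q r \<and> r \<le> Max (x (fst z) ` snd z)" if "r \<in> Q" for r
            using that \<phi>(2,3)[of r] by (auto simp: Q_def)
          show "disjoint_family_on (\<lambda>r. {q r<..<r}) Q"
            using disjoint by (rule disjoint_family_on_mono[rotated]) (auto simp: Q_def)
          show "Min (x (fst z) ` snd z) \<le> Max (x (fst z) ` snd z)"
            using spread_nonneg[OF comps_finite[OF z'] comps_nonempty[OF z'], of "x (fst z)"]
            by (simp add: spread_def)
        qed (use q(1) \<open>finite Q\<close> in auto)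
      qed (use q(1) in auto)
      finally show "(\<Sum>r\<in>{r \<in> R'. \<phi> r = z}. (r - q r)\<^sup>2) \<le> (spread (x (fst z)) (snd z))\<^sup>2"
        by (simp add: Q_def)
    qed
    finally show ?thesis by (simp add: case_prod_unfold)
  qed
  define X Y where "X = (\<Sum>K\<in>\<C>. b K - a K)" and "Y = (\<Sum>r\<in>R. r - q r)"
  obtain i j where ij: "i \<in> S" "j \<in> S" "Max (x t0 ` S) = x t0 i" "Min (x t0 ` S) = x t0 j"
    by (rule spread_attained[OF S(2) \<open>S \<noteq> {}\<close>])
  obtain K K' where K: "K \<in> \<C>" "j \<in> K" "K' \<in> \<C>" "i \<in> K'"
    using comps_member[OF S(1)] ij unfolding \<C>_def by metis
  have "spread (x t0) S \<le> b K' - a K"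
    using in_comp[OF K(1,2)] in_comp[OF K(3,4)] ij by (simp add: spread_def)
  also have "\<dots> \<le> X + Y" using q(4)[OF K(1,3)] by (simp add: X_def Y_def)
  finally have "(spread (x t0) S)\<^sup>2 \<le> (X + Y)\<^sup>2"
    using spread_nonneg[OF S(2) \<open>S \<noteq> {}\<close>] by (intro power_mono)
  also have "\<dots> \<le> 2 * (X\<^sup>2 + Y\<^sup>2)"
    using zero_le_power2[of "X - Y"] by (simp add: power2_eq_square algebra_simps)
  \<comment> \<open>Cauchy-Schwarz for at most \<open>m\<close> intervals and for at most
    \<open>m\<close> gaps.\<close>
  also have "\<dots> \<le> 2 * (real m * (\<Sum>K\<in>\<C>. (b K - a K)\<^sup>2) + real m * (\<Sum>r\<in>R. (r - q r)\<^sup>2))"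
    unfolding X_def Y_def by (intro mult_left_mono add_mono square_sum_le_card fin) simp
  also have "\<dots> = 2 * real m * ((\<Sum>K\<in>\<C>. (b K - a K)\<^sup>2) + (\<Sum>r\<in>R. (r - q r)\<^sup>2))"
    by (simp add: distrib_left mult.assoc)
  also have "\<dots> \<le> 2 * real m * (\<Sum>t\<in>{t0..t1}. \<Sum>K\<in>comps t S. (spread (x t) K)\<^sup>2)"
  proof (intro mult_left_mono)
    have "(\<Sum>t\<in>{t0..t1}. \<Sum>K\<in>comps t S. (spread (x t) K)\<^sup>2)
      = (\<Sum>K\<in>\<C>. (b K - a K)\<^sup>2) + (\<Sum>t\<in>{t0<..t1}. \<Sum>K\<in>comps t S. (spread (x t) K)\<^sup>2)"
      using \<open>t0 \<le> t1\<close> by (simp add: sum.head \<C>_def a_def b_def spread_def)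
    also have "(\<Sum>t\<in>{t0<..t1}. \<Sum>K\<in>comps t S. (spread (x t) K)\<^sup>2) = (\<Sum>(t, K)\<in>Z. (spread (x t) K)\<^sup>2)"
      unfolding Z_def by (intro sum.Sigma) (auto simp: finite_comps)
    finally show "(\<Sum>K\<in>\<C>. (b K - a K)\<^sup>2) + (\<Sum>r\<in>R. (r - q r)\<^sup>2)
      \<le> (\<Sum>t\<in>{t0..t1}. \<Sum>K\<in>comps t S. (spread (x t) K)\<^sup>2)"
      using late by simp
  qed simp
  finally show ?thesis .
qed

text \<open>The initial squared deviation is at most \<open>4 * m * card S\<close> times
  \<open>W\<close>, the accumulated deviations within components, while the potential drops by
  \<open>h^2 / d^2\<close> times \<open>W\<close>.\<close>

lemma sqdev_contraction:
  assumes iso: "\<And>t. t0 \<le> t \<Longrightarrow> t \<le> t1 \<Longrightarrow> isolated t S" and "t0 \<le> t1"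
    and "S \<noteq> {}" and m: "card (comps t0 S) \<le> m" "0 < m"
    and crossed: "\<And>p. \<exists>i\<in>S. x t0 i \<le> p \<Longrightarrow> \<exists>j\<in>S. p < x t0 j \<Longrightarrow>
      \<exists>t\<in>{t0..t1}. \<exists>i\<in>S. \<exists>j\<in>S. x t0 i \<le> p \<and> p < x t0 j \<and> A t i j"
  shows "real d * sqdev (x (Suc t1)) S
    \<le> (1 - h\<^sup>2 / (4 * real d ^ 3 * real m * real (card S))) * (real d * sqdev (x t0) S)"
proof -
  define W where "W = (\<Sum>t\<in>{t0..t1}. \<Sum>K\<in>comps t S. sqdev (x t) K)"
  have S: "finite S" using iso[of t0] \<open>t0 \<le> t1\<close> isolated_finite by auto
  then have N: "0 < real (card S)" using \<open>S \<noteq> {}\<close> by (simp add: card_gt_0_iff)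
  \<comment> \<open>The graph at \<open>t1\<close> acts only in passing to \<open>Suc t1\<close>,
    hence the contraction is stated there.\<close>
  have "{t0..<Suc t1} = {t0..t1}" by auto
  then have dec: "real d * sqdev (x (Suc t1)) S + (h\<^sup>2 / (real d)\<^sup>2) * W \<le> real d * sqdev (x t0) S"
    using sqdev_decrease_interval[of t0 "Suc t1" S] iso \<open>t0 \<le> t1\<close> by (simp add: W_def)
  have "sqdev (x t0) S \<le> real (card S) * (spread (x t0) S)\<^sup>2"
    by (rule sqdev_le_spread_sq[OF S \<open>S \<noteq> {}\<close>])
  also have "\<dots> \<le> real (card S) * (2 * real m * (\<Sum>t\<in>{t0..t1}. \<Sum>K\<in>comps t S. (spread (x t) K)\<^sup>2))"
    by (intro mult_left_mono spread_sq_le_component_spreads assms) auto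
  also have "\<dots> \<le> real (card S) * (2 * real m * (\<Sum>t\<in>{t0..t1}. \<Sum>K\<in>comps t S. 2 * sqdev (x t) K))"
    using comps_finite comps_nonempty
    by (intro mult_left_mono sum_mono spread_sq_le_sqdev) auto
  also have "\<dots> = 4 * real m * real (card S) * W"
    by (simp add: W_def sum_distrib_left mult_ac)
  finally have "h\<^sup>2 / (4 * real d ^ 3 * real m * real (card S)) * (real d * sqdev (x t0) S)
      \<le> h\<^sup>2 / (4 * real d ^ 3 * real m * real (card S)) * (real d * (4 * real m * real (card S) * W))"
    by (intro mult_left_mono) auto
  also have "\<dots> = h\<^sup>2 / (real d)\<^sup>2 * W"
    using d_pos N m by (simp add: field_simps power2_eq_square power3_eq_cube)
  finally show ?thesis using dec by (simp add: algebra_simps)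
qed

end

subsection \<open>Recursion on the number of components\<close>

context averaging
begin

lemma comps_split:
  assumes "isolated t L" "isolated t (S - L)" "L \<subseteq> S"
  shows "comps t S = comps t L \<union> comps t (S - L)" "comps t L \<inter> comps t (S - L) = {}"
proof -
  have "K \<subseteq> L \<or> K \<subseteq> S - L" if K: "K \<in> comps t S" for K
  proof -
    obtain i where i: "i \<in> K" using comps_nonempty[OF K] by blast
    show ?thesis
      using component_subset_isolated[OF _ comps_component[OF K] i] comps_subset[OF K] i assms(1,2)
      by blast
  qed
  then show "comps t S = comps t L \<union> comps t (S - L)" using assms(3) by (auto simp: comps_def)
  show "comps t L \<inter> comps t (S - L) = {}"
    using comps_nonempty[of _ t L] comps_subset[of _ t L] comps_subset[of _ t "S - L"] by blast
qed

lemma energy_split: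
  assumes "isolated t L" "isolated t (S - L)" "L \<subseteq> S"
  shows "energy s t S = energy s t L + energy s t (S - L)"
  unfolding energy_def comps_split(1)[OF assms]
  by (intro sum.union_disjoint finite_comps comps_split(2)[OF assms])

text \<open>Both parts are nonempty, so each takes at least one component away from the
  other.\<close>

lemma card_comps_split:
  assumes "isolated t L" "isolated t (S - L)" "L \<subseteq> S" "L \<noteq> {}" "S - L \<noteq> {}"
    and "card (comps t S) \<le> Suc m"
  shows "card (comps t L) \<le> m" "card (comps t (S - L)) \<le> m"
proof -
  have "card (comps t S) = card (comps t L) + card (comps t (S - L))"
    unfolding comps_split(1)[OF assms(1-3)]
    by (intro card_Un_disjoint finite_comps comps_split(2)[OF assms(1-3)])
  moreover have "comps t L \<noteq> {}" "comps t (S - L) \<noteq> {}"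
    using Union_comps[OF assms(1)] Union_comps[OF assms(2)] assms(4,5) by auto
  then have "0 < card (comps t L)" "0 < card (comps t (S - L))"
    using finite_comps by (auto simp: card_gt_0_iff)
  ultimately show "card (comps t L) \<le> m" "card (comps t (S - L)) \<le> m" using assms(6) by auto
qed

text \<open>Induction on \<open>m\<close>, and inside it on the horizon \<open>T - t0\<close>: an
  uncrossed phase, the single time \<open>t1\<close> at which the last cut is crossed, and a restart
  with contracted potential. The factor \<open>card S\<close> instead of \<open>n\<close> lets the
  two sides of a cut share the bound in proportion to their sizes.\<close>

lemma energy_bound:
  assumes s: "0 < s" "s \<le> 1" and "1 \<le> m" and "S \<subseteq> {..<n}"
    and "\<And>t. t0 \<le> t \<Longrightarrow> t < T \<Longrightarrow> isolated t S \<and> card (comps t S) \<le> m"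
  shows "(\<Sum>t\<in>{t0..<T}. energy s t S) \<le> (real d * sqdev (x t0) S) powr (s / 2)
    * (16 * real d ^ 3 * real m * real (card S) / (h\<^sup>2 * s)) ^ m"
  using assms(3-5)
proof (induction m arbitrary: S t0 T rule: nat_induct_at_least)
  case base
  show ?case
  proof (cases "S = {}")
    case True
    then have "energy s t S = 0" for t
      using comps_nonempty comps_subset[of _ t S] unfolding energy_def by (intro sum.neutral) blast
    then show ?thesis using s by (simp add: zero_le_mult_iff)
  next
    case False
    then have "1 \<le> real (card S)"
      using finite_subset[OF base(1)] by (simp add: Suc_le_eq card_gt_0_iff)
    then have "2 * real d ^ 3 * 1 \<le> 16 * real d ^ 3 * real (card S)"
      by (intro mult_mono) auto
    then have "2 * real d ^ 3 / (h\<^sup>2 * s) \<le> 16 * real d ^ 3 * real (card S) / (h\<^sup>2 * s)"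
      using s by (intro divide_right_mono) auto
    then have "(real d * sqdev (x t0) S) powr (s / 2) * (2 * real d ^ 3 / (h\<^sup>2 * s))
      \<le> (real d * sqdev (x t0) S) powr (s / 2) * (16 * real d ^ 3 * real (card S) / (h\<^sup>2 * s))"
      by (rule mult_left_mono) simp
    moreover have "(\<Sum>t\<in>{t0..<T}. energy s t S)
      \<le> (real d * sqdev (x t0) S) powr (s / 2) * (2 * real d ^ 3 / (h\<^sup>2 * s))"
      using base(2) by (intro connected_energy_bound s) auto
    ultimately show ?thesis by simp
  qed
next
  case (Suc m)
  note outer = Suc.IH
  define c where "c = 16 * real d ^ 3 * real (Suc m) * real (card S) / (h\<^sup>2 * s)"
  define V where "V t = real d * sqdev (x t) S" for t
  have V0: "0 \<le> V t" for t by (simp add: V_def sqdev_nonneg)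
  have S: "finite S" using Suc.prems(1) finite_subset by auto
  have c0: "0 \<le> c" using s by (simp add: c_def)
  have split_bound: "(\<Sum>t\<in>{t0..<\<tau>}. energy s t S) \<le> V t0 powr (s / 2) * c ^ m"
    if \<tau>: "\<And>t. t0 \<le> t \<Longrightarrow> t < \<tau> \<Longrightarrow> isolated t S \<and> card (comps t S) \<le> Suc m"
      and cut: "\<exists>i\<in>S. x t0 i \<le> p" "\<exists>j\<in>S. p < x t0 j"
      and uncrossed: "\<And>t i j. t0 \<le> t \<Longrightarrow> t < \<tau> \<Longrightarrow> i \<in> S \<Longrightarrow> j \<in> S \<Longrightarrow>
        x t0 i \<le> p \<Longrightarrow> p < x t0 j \<Longrightarrow> \<not> A t i j"
    for t0 \<tau> p
  proof -
    define L where "L = {i \<in> S. x t0 i \<le> p}"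
    have L: "L \<subseteq> S" "L \<noteq> {}" "S - L \<noteq> {}" using cut by (auto simp: L_def)
    have sides: "isolated t L" "isolated t (S - L)" if t: "t0 \<le> t" "t < \<tau>" for t
    proof -
      have S': "isolated t S" using \<tau> t by blast
      have no: "\<not> A t i j" if "i \<in> L" "j \<in> S - L" for i j
        using that uncrossed[OF t, of i j] by (auto simp: L_def)
      show "isolated t L" using S' no unfolding isolated_def L_def by blast
      show "isolated t (S - L)" using S' no edge_sym[of t] unfolding isolated_def L_def by blast
    qed
    have part: "(\<Sum>t\<in>{t0..<\<tau>}. energy s t M)
        \<le> V t0 powr (s / 2) * (c ^ m * (real (card M) / real (card S)))"
      if M: "M \<subseteq> S" "M \<noteq> {}"
        "\<And>t. t0 \<le> t \<Longrightarrow> t < \<tau> \<Longrightarrow> isolated t M \<and> card (comps t M) \<le> m" for M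
    proof -
      define \<theta> where "\<theta> = real (card M) / real (card S)"
      have card: "0 < real (card S)" "card M \<le> card S"
        using M S by (auto simp: card_gt_0_iff card_mono)
      then have \<theta>: "0 \<le> \<theta>" "\<theta> \<le> 1" by (auto simp: \<theta>_def)
      have "(\<Sum>t\<in>{t0..<\<tau>}. energy s t M) \<le> (real d * sqdev (x t0) M) powr (s / 2)
          * (16 * real d ^ 3 * real m * real (card M) / (h\<^sup>2 * s)) ^ m"
        using M Suc.prems(1) by (intro outer) auto
      also have "\<dots> \<le> V t0 powr (s / 2) * (c * \<theta>) ^ m"
      proof (intro mult_mono powr_mono2 power_mono)
        show "real d * sqdev (x t0) M \<le> V t0"
          unfolding V_def using sqdev_mono[OF S M(1)] by (intro mult_left_mono) auto
        have "c * \<theta> = 16 * real d ^ 3 * real (Suc m) * real (card M) / (h\<^sup>2 * s)"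
          using card by (simp add: c_def \<theta>_def)
        also have "\<dots> \<ge> 16 * real d ^ 3 * real m * real (card M) / (h\<^sup>2 * s)"
          using s by (intro divide_right_mono mult_right_mono mult_left_mono) auto
        finally show "16 * real d ^ 3 * real m * real (card M) / (h\<^sup>2 * s) \<le> c * \<theta>" .
      qed (use s in \<open>auto simp: sqdev_nonneg\<close>)
      also have "\<dots> \<le> V t0 powr (s / 2) * (c ^ m * \<theta>)"
      proof -
        have "\<theta> ^ m \<le> \<theta> ^ 1" using \<theta> Suc.hyps by (intro power_decreasing) auto
        then show ?thesis
          using c0 by (auto simp: power_mult_distrib intro!: mult_left_mono)
      qed
      finally show ?thesis by (simp add: \<theta>_def)
    qed
    have "(\<Sum>t\<in>{t0..<\<tau>}. energy s t S)
        = (\<Sum>t\<in>{t0..<\<tau>}. energy s t L) + (\<Sum>t\<in>{t0..<\<tau>}. energy s t (S - L))"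
      unfolding sum.distrib[symmetric]
      by (intro sum.cong refl energy_split) (use sides L in auto)
    also have "\<dots> \<le> V t0 powr (s / 2) * (c ^ m * (real (card L) / real (card S)))
        + V t0 powr (s / 2) * (c ^ m * (real (card (S - L)) / real (card S)))"
    proof (intro add_mono part)
      fix t assume t: "t0 \<le> t" "t < \<tau>"
      have "card (comps t S) \<le> Suc m" using \<tau>[OF t] by blast
      then show "isolated t L \<and> card (comps t L) \<le> m"
        "isolated t (S - L) \<and> card (comps t (S - L)) \<le> m"
        using sides[OF t] card_comps_split[OF sides[OF t] L] by auto
    qed (use L in auto)
    also have "\<dots> = V t0 powr (s / 2) * c ^ m * (real (card L + card (S - L)) / real (card S))"
      by (simp add: distrib_left add_divide_distrib)
    also have "card L + card (S - L) = card S"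
      using L S by (simp add: card_Diff_subset finite_subset card_mono)
    also have "real (card S) / real (card S) = 1" using L S by auto
    finally show ?thesis by simp
  qed
  have "(\<Sum>t\<in>{t0..<T}. energy s t S) \<le> V t0 powr (s / 2) * c ^ Suc m"
    using Suc.prems(2)
  proof (induction "T - t0" arbitrary: t0 rule: less_induct)
    case less
    consider "T \<le> t0 \<or> S = {}" | "t0 < T" "S \<noteq> {}" by linarith
    then show ?case
    proof cases
      case 1
      have "energy s t S = 0" if "S = {}" for t
        using that comps_nonempty comps_subset[of _ t S] unfolding energy_def
        by (intro sum.neutral) blast
      with 1 have "(\<Sum>t\<in>{t0..<T}. energy s t S) = 0" by auto
      then show ?thesis using c0 by simp
    next
      case 2
      \<comment> \<open>Thresholds refer to the values at \<open>t0\<close>, so the two sides of a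
        cut are fixed sets of agents.\<close>
      define crossed where "crossed t1 \<longleftrightarrow> (\<forall>p. (\<exists>i\<in>S. x t0 i \<le> p) \<longrightarrow> (\<exists>j\<in>S. p < x t0 j) \<longrightarrow>
        (\<exists>t\<in>{t0..t1}. \<exists>i\<in>S. \<exists>j\<in>S. x t0 i \<le> p \<and> p < x t0 j \<and> A t i j))" for t1
      \<comment> \<open>The phase ends at \<open>\<tau> - 1\<close>; \<open>\<tau> = t0\<close> is
        the empty phase and is set apart because the predecessor is then no time of the
        phase.\<close>
      have uncrossed_bound: "(\<Sum>t\<in>{t0..<\<tau>}. energy s t S) \<le> V t0 powr (s / 2) * c ^ m"
        if \<tau>: "\<tau> \<le> T" "\<tau> \<noteq> t0 \<Longrightarrow> \<not> crossed (\<tau> - 1)" "t0 \<le> \<tau>" for \<tau>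
      proof (cases "\<tau> = t0")
        case True
        then show ?thesis using c0 by simp
      next
        case False
        then obtain p where p: "\<exists>i\<in>S. x t0 i \<le> p" "\<exists>j\<in>S. p < x t0 j"
          "\<not> (\<exists>t\<in>{t0..\<tau> - 1}. \<exists>i\<in>S. \<exists>j\<in>S. x t0 i \<le> p \<and> p < x t0 j \<and> A t i j)"
          using \<tau>(2) unfolding crossed_def by blast
        have "{t0..\<tau> - 1} = {t0..<\<tau>}" using False \<tau>(3) by auto
        then show ?thesis
          using p less.prems \<tau>(1) by (intro split_bound[of t0 \<tau> p]) auto
      qed
      have N: "1 \<le> real (card S)" using 2 S by (simp add: Suc_le_eq card_gt_0_iff)
      have iso0: "isolated t0 S" using less.prems 2 by auto
      obtain K where K: "K \<in> comps t0 S" using Union_comps[OF iso0] 2 by blast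
      have hd: "h\<^sup>2 \<le> real d ^ 3" by (rule h_sq_le_d_cube[OF comps_component[OF K]])
      have "real (Suc m) * (h\<^sup>2 * s) \<le> real (Suc m) * (real d ^ 3 * 1)"
        using hd s by (intro mult_left_mono mult_mono) auto
      also have "\<dots> \<le> 16 * real d ^ 3 * real (Suc m) * real (card S)"
        using mult_mono[of 1 "16 * real (card S)" "real (Suc m) * real d ^ 3" "real (Suc m) * real d ^ 3"] N
        by (simp add: mult_ac)
      \<comment> \<open>Since \<open>h^2 <= d^3\<close>, the trivial energy bound at the single time
        \<open>t1\<close> costs no more than \<open>c ^ m\<close>.\<close>
      finally have c_ge: "real (Suc m) \<le> c"
        using s h_pos by (simp add: c_def pos_le_divide_eq)
      then have "c ^ 1 \<le> c ^ m" using Suc.hyps by (intro power_increasing) auto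
      with c_ge have m_le: "real (Suc m) \<le> c ^ m" by simp
      show ?thesis
      proof (cases "\<exists>t1. t0 \<le> t1 \<and> t1 < T \<and> crossed t1")
        \<comment> \<open>Some cut stays uncrossed up to the horizon, so the split bound already
          covers the whole sum.\<close>
        case False
        have "(\<Sum>t\<in>{t0..<T}. energy s t S) \<le> V t0 powr (s / 2) * c ^ m"
          using False 2 by (intro uncrossed_bound) auto
        also have "\<dots> \<le> V t0 powr (s / 2) * c ^ Suc m"
          using c_ge by (intro mult_left_mono power_increasing) auto
        finally show ?thesis .
      next
        case True
        define t1 where "t1 = (LEAST t1. t0 \<le> t1 \<and> t1 < T \<and> crossed t1)"
        have t1: "t0 \<le> t1" "t1 < T" "crossed t1"
          using LeastI_ex[OF True] by (auto simp: t1_def)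
        have before: "\<not> crossed (t1 - 1)" if "t1 \<noteq> t0"
          using not_less_Least[of "t1 - 1" "\<lambda>t1. t0 \<le> t1 \<and> t1 < T \<and> crossed t1"] t1 that
          by (auto simp: t1_def[symmetric])
        have iso: "isolated t S" if "t0 \<le> t" "t \<le> t1" for t using that less.prems t1 by auto
        define \<delta> where "\<delta> = h\<^sup>2 / (4 * real d ^ 3 * real (Suc m) * real (card S))"
        \<comment> \<open>The constant 16 in \<open>c\<close> is chosen for the value 2: the
          contraction must repay one \<open>c ^ m\<close> for the uncrossed phase and another for
          time \<open>t1\<close>.\<close>
        have \<delta>: "0 \<le> \<delta>" "\<delta> \<le> 1" "\<delta> * s / 2 * c = 2"
        proof -
          have "real d ^ 3 * 1 \<le> real d ^ 3 * (4 * real (Suc m) * real (card S))"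
            using mult_mono[of 1 "4 * real (Suc m)" 1 "real (card S)"] N by (intro mult_left_mono) auto
          also have "\<dots> = 4 * real d ^ 3 * real (Suc m) * real (card S)" by (simp only: mult_ac)
          finally have "h\<^sup>2 \<le> 4 * real d ^ 3 * real (Suc m) * real (card S)" using hd by simp
          then show "\<delta> \<le> 1" using d_pos N by (simp add: \<delta>_def divide_le_eq)
          show "0 \<le> \<delta>" by (simp add: \<delta>_def)
          define w where "w = real d ^ 3 * real (Suc m) * real (card S)"
          have "0 < w" using d_pos N by (simp add: w_def)
          moreover have "\<delta> = h\<^sup>2 / (4 * w)" "c = 16 * w / (h\<^sup>2 * s)"
            by (simp_all only: \<delta>_def c_def w_def mult.assoc)
          ultimately show "\<delta> * s / 2 * c = 2" using s h_pos by simp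
        qed
        have "V (Suc t1) \<le> (1 - \<delta>) * V t0"
          unfolding V_def \<delta>_def
          using t1 2 less.prems iso by (intro sqdev_contraction) (auto simp: crossed_def)
        then have after: "V (Suc t1) powr (s / 2) \<le> (1 - \<delta> * s / 2) * V t0 powr (s / 2)"
          using powr_contraction_le[of "s / 2" \<delta> "V (Suc t1)" "V t0"] s \<delta>(1,2) V0
          by (simp add: mult.commute)
        have "(\<Sum>t\<in>{t0..<T}. energy s t S)
            = (\<Sum>t\<in>{t0..<t1}. energy s t S) + (energy s t1 S + (\<Sum>t\<in>{Suc t1..<T}. energy s t S))"
          using t1 sum.atLeastLessThan_concat[of t0 t1 T "\<lambda>t. energy s t S"]
          by (simp add: sum.atLeast_Suc_lessThan[of t1 T])
        also have "\<dots> \<le> V t0 powr (s / 2) * c ^ m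
            + (real (Suc m) * V t0 powr (s / 2) + (1 - \<delta> * s / 2) * V t0 powr (s / 2) * c ^ Suc m)"
        proof (intro add_mono)
          show "(\<Sum>t\<in>{t0..<t1}. energy s t S) \<le> V t0 powr (s / 2) * c ^ m"
            using t1 before by (intro uncrossed_bound) auto
          have "V t1 \<le> V t0"
            unfolding V_def using iso t1 by (intro mult_left_mono sqdev_antimono) auto
          then have "real (Suc m) * V t1 powr (s / 2) \<le> real (Suc m) * V t0 powr (s / 2)"
            using s V0 by (intro mult_left_mono powr_mono2) auto
          moreover have "energy s t1 S \<le> real (Suc m) * V t1 powr (s / 2)"
            unfolding V_def using less.prems t1 s by (intro energy_le_card S) auto
          ultimately show "energy s t1 S \<le> real (Suc m) * V t0 powr (s / 2)" by linarith
          have "(\<Sum>t\<in>{Suc t1..<T}. energy s t S) \<le> V (Suc t1) powr (s / 2) * c ^ Suc m"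
            using less.prems t1 by (intro less.hyps) auto
          also have "\<dots> \<le> (1 - \<delta> * s / 2) * V t0 powr (s / 2) * c ^ Suc m"
            using after c0 by (intro mult_right_mono) auto
          finally show "(\<Sum>t\<in>{Suc t1..<T}. energy s t S)
            \<le> (1 - \<delta> * s / 2) * V t0 powr (s / 2) * c ^ Suc m" .
        qed
        also have "\<dots> = V t0 powr (s / 2) * (c ^ m + real (Suc m) + c ^ Suc m - \<delta> * s / 2 * c * c ^ m)"
          by (simp add: algebra_simps)
        also have "\<dots> \<le> V t0 powr (s / 2) * c ^ Suc m"
          unfolding \<delta>(3) using m_le by (intro mult_left_mono) auto
        finally show ?thesis .
      qed
    qed
  qed
  then show ?case by (simp add: V_def c_def)
qed

section \<open>From isolated sets to all agents and the infinite sum\<close>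

lemma isolated_all: "isolated t {..<n}"
  using edge_less by (auto simp: isolated_def)

lemma comps_all: "comps t {..<n} = graph_components n (A t)"
  using component_subset by (auto simp: comps_def)

text \<open>The bound is uniform in the horizon \<open>T\<close> and the terms are nonnegative, so
  the series converges. The normalisation of \<open>x 0\<close> makes the initial potential at most
  1, so its power drops out.\<close>

lemma block_energy_summable:
  assumes s: "0 < s" "s \<le> 1"
    and V: "(\<Sum>i<n. real d * (x 0 i - (\<Sum>k<n. x 0 k) / real n)\<^sup>2) \<le> 1"
    and bound: "\<And>T. (\<Sum>t\<in>{0..<T}. energy s t {..<n})
      \<le> (real d * sqdev (x 0) {..<n}) powr (s / 2) * B"
    and "0 \<le> B"
  shows "summable (\<lambda>t. block_energy s n (A t) (x t)) \<and> (\<Sum>t. block_energy s n (A t) (x t)) \<le> B"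
proof -
  have nonneg: "0 \<le> block_energy s n (A t) (x t)" for t
    unfolding block_energy_def by (intro sum_nonneg) auto
  have "real d * sqdev (x 0) {..<n} \<le> 1"
    using V by (simp add: sqdev_def mean_def sum_distrib_left)
  then have "(real d * sqdev (x 0) {..<n}) powr (s / 2) \<le> 1"
    using s powr_mono2[of "s / 2" "real d * sqdev (x 0) {..<n}" 1] by (simp add: sqdev_nonneg)
  then have le_B: "(real d * sqdev (x 0) {..<n}) powr (s / 2) * B \<le> B"
    using \<open>0 \<le> B\<close> by (simp add: mult_left_le_one_le)
  have partial: "(\<Sum>t<T. block_energy s n (A t) (x t)) \<le> B" for T
  proof -
    have "(\<Sum>t<T. block_energy s n (A t) (x t)) \<le> (\<Sum>t<T. energy s t {..<n})"
      using block_energy_le[OF s] by (intro sum_mono) (simp add: energy_def comps_all)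
    also have "\<dots> \<le> B" using bound[of T] le_B by (simp add: atLeast0LessThan)
    finally show ?thesis .
  qed
  have "summable (\<lambda>t. block_energy s n (A t) (x t))"
    by (rule summableI_nonneg_bounded[OF nonneg partial])
  then show ?thesis using suminf_le_const partial by blast
qed

end

lemma averaging_system:
  assumes "2 \<le> d" "0 < h" "exp_averaging_system n d h m A x"
  shows "averaging n d h A x"
  using assms unfolding exp_averaging_system_def by unfold_locales auto

theorem theorem1:
  shows "\<exists>C::real. C > 0 \<and>
    (\<forall>s::real. 0 < s \<and> s \<le> 1 \<longrightarrow>
      (\<forall>(n::nat) (d::nat) (h::real) A x. 2 \<le> n \<and> 2 \<le> d \<and> 0 < h \<and>
          exp_averaging_system n d h 1 A x \<and>
          (\<Sum>i<n. real d * (x 0 i - (\<Sum>k<n. x 0 k) / real n)\<^sup>2) \<le> 1 \<longrightarrow>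
          summable (\<lambda>t. block_energy s n (A t) (x t)) \<and>
          (\<Sum>t. block_energy s n (A t) (x t)) \<le> C * real d ^ 3 / (s * h\<^sup>2)) \<and>
      (\<forall>(n::nat) (d::nat) (h::real) (m::nat) A x. 2 \<le> n \<and> 2 \<le> d \<and> 0 < h \<and>
          1 \<le> m \<and> m \<le> n - 1 \<and>
          exp_averaging_system n d h m A x \<and>
          (\<Sum>i<n. real d * (x 0 i - (\<Sum>k<n. x 0 k) / real n)\<^sup>2) \<le> 1 \<longrightarrow>
          summable (\<lambda>t. block_energy s n (A t) (x t)) \<and>
          (\<Sum>t. block_energy s n (A t) (x t))
            \<le> ((C * real d ^ 3 * real m * real n / h\<^sup>2) / s) ^ m))"
\<comment> \<open>The recursion on components dictates 16; the connected case alone would do with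
  2.\<close>
proof (intro exI[of _ 16] conjI allI impI; (elim conjE)?)
  show "(0::real) < 16" by simp
next
  fix s h :: real and n d :: nat and A x
  assume s: "0 < s" "s \<le> 1" and "2 \<le> d" "0 < h" and sys: "exp_averaging_system n d h 1 A x"
    and V: "(\<Sum>i<n. real d * (x 0 i - (\<Sum>k<n. x 0 k) / real n)\<^sup>2) \<le> 1"
  interpret averaging n d h A x by (rule averaging_system[OF \<open>2 \<le> d\<close> \<open>0 < h\<close> sys])
  have "card (comps t {..<n}) \<le> 1" for t
    using sys by (simp add: comps_all exp_averaging_system_def)
  then have "summable (\<lambda>t. block_energy s n (A t) (x t)) \<and>
      (\<Sum>t. block_energy s n (A t) (x t)) \<le> 2 * real d ^ 3 / (h\<^sup>2 * s)"
    using s by (intro block_energy_summable[OF s V] connected_energy_bound) (auto simp: isolated_all)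
  moreover have "2 * real d ^ 3 / (h\<^sup>2 * s) \<le> 16 * real d ^ 3 / (s * h\<^sup>2)"
    using s by (simp add: mult.commute divide_right_mono)
  ultimately show "summable (\<lambda>t. block_energy s n (A t) (x t))"
    "(\<Sum>t. block_energy s n (A t) (x t)) \<le> 16 * real d ^ 3 / (s * h\<^sup>2)" by auto
next
  fix s h :: real and n d m :: nat and A x
  assume s: "0 < s" "s \<le> 1" and "2 \<le> d" "0 < h" "1 \<le> m" and sys: "exp_averaging_system n d h m A x"
    and V: "(\<Sum>i<n. real d * (x 0 i - (\<Sum>k<n. x 0 k) / real n)\<^sup>2) \<le> 1"
  interpret averaging n d h A x by (rule averaging_system[OF \<open>2 \<le> d\<close> \<open>0 < h\<close> sys])
  have "card (comps t {..<n}) \<le> m" for t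
    using sys by (simp add: comps_all exp_averaging_system_def)
  then have "summable (\<lambda>t. block_energy s n (A t) (x t)) \<and>
      (\<Sum>t. block_energy s n (A t) (x t))
        \<le> (16 * real d ^ 3 * real m * real (card {..<n}) / (h\<^sup>2 * s)) ^ m"
    using s \<open>1 \<le> m\<close> by (intro block_energy_summable[OF s V] energy_bound) (auto simp: isolated_all)
  then show "summable (\<lambda>t. block_energy s n (A t) (x t))"
    "(\<Sum>t. block_energy s n (A t) (x t)) \<le> (16 * real d ^ 3 * real m * real n / h\<^sup>2 / s) ^ m" by auto
qed

end
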